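(* Let $u$ be a Dirichlet (or Neumann) eigenfunction of the Laplacian on $\mathcal{SG}$, with level of fixation $m_1$ and graph eigenvalues $\lambda_k$, and let $E$ be an $m$-edge in $\mathcal{SG}$ with $m\ge m_1-1$. Suppose $u$ is non-constant on $E$. Then: (1) if $\frac{1}{4-\lambda_{m+1}}\le r^E(u)\le 4-\lambda_{m+1}$, then $u|_E$ is strictly monotone; (2) otherwise (including $r^E(u)=\infty$) $u|_E$ has a single extremum. Moreover, define $$\alpha^E(u)=\lim_{l\to\infty}\frac{|u(p_1^{E_{0^l}})-u(p_0^E)|}{|p_1^{E_{0^l}}-p_0^E|},\qquad \beta^E(u)=\lim_{l\to\infty}\frac{|u(p_0^{E_{1^l}})-u(p_1^E)|}{|p_0^{E_{1^l}}-p_1^E|}.$$ Then $\alpha^E(u)=0$ when $r^E(u)=4-\lambda_{m+1}$ and $\alpha^E(u)=\infty$ when $r^E(u)\ne 4-\lambda_{m+1}$; and $\beta^E(u)=0$ when $r^E(u)=\frac1{4-\lambda_{m+1}}$ and $\beta^E(u)=\infty$ when $r^E(u)\ne\frac1{4-\lambda_{m+1}}$.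
   Context: Sierpinski gasket. Let $q_0,q_1,q_2$ be the vertices of an equilateral triangle in $\mathbb{R}^2$, $F_i(x)=\frac12(x-q_i)+q_i$, and $\mathcal{SG}$ the attractor of $\{F_0,F_1,F_2\}$. Put $V_0=\{q_0,q_1,q_2\}$, $V_m=\bigcup_iF_iV_{m-1}$, $V_*=\bigcup_mV_m$; for a word $w=w_1\cdots w_m$, $w_i\in\{0,1,2\}$, $F_w=F_{w_1}\circ\cdots\circ F_{w_m}$, and $F_w\mathcal{SG}$ is an $m$-cell with boundary vertices $F_wV_0$. For $x\ne y$ in $V_m$, $x\sim_my$ iff $x,y\in F_wV_0$ for some $|w|=m$. An $m$-edge is a line segment joining two distinct boundary vertices of an $m$-cell. Laplacian. $\Delta_mu(x)=\sum_{y\sim_mx}(u(y)-u(x))$ for $x\in V_m\setminus V_0$, and $\Delta u(x)=\frac32\lim_{m\to\infty}5^m\Delta_mu(x)$, with $u\in\mathrm{dom}\,\Delta$ iff the limit converges uniformly on $V_*\setminus V_0$ to a continuous function. An eigenfunction is a non-zero (continuous) $u$ with $-\Delta u=\lambda u$. It is Dirichlet if $u|_{V_0}=0$ and Neumann if its normal derivatives $\lim_m(\frac53)^m\sum_{j\neq i}(u(q_i)-u(F_i^mq_j))$ vanish at each $q_i$ (in the Neumann case graph eigenvalue equations are also required at $q_i\in V_0$ by even reflection: $2\sum_{y\sim_mq_i}(u(q_i)-u(y))=\lambda_mu(q_i)$). Spectral decimation (known). For such an eigenfunction there is a minimal integer $m_0$ (level of birth) such that for all $m\ge m_0$, $u|_{V_m}$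 is an eigenfunction of $-\Delta_m$ with eigenvalue $\lambda_m$, where $\lambda_m=\lambda_{m+1}(5-\lambda_{m+1})$ and $\lambda=\frac32\lim_m5^m\lambda_m$. Thus $\lambda_{m+1}=\frac{5+\varepsilon_{m+1}\sqrt{25-4\lambda_m}}2$ with $\varepsilon_{m+1}=\pm1$ for $m\ge m_0$; $\{\varepsilon_m\}_{m>m_0}$ is the $\varepsilon$-sequence, with only finitely many $\varepsilon_m=1$. The level of fixation is the minimal integer $m_1>m_0$ with $\varepsilon_m=-1$ for all $m\ge m_1$. For non-constant Dirichlet/Neumann eigenfunctions $\lambda_{m_0}\in\{2,5,6\}$ ($2$-, $5$-, $6$-series), and $\lambda_{m_0+1}=3$ ($\varepsilon_{m_0+1}=1$) if $\lambda_{m_0}=6$. For $m\ge m_0$ and an $m$-cell with boundary vertices $p_0,p_1,p_2$, $$u(p_{ij})=\frac{(4-\lambda_{m+1})(u(p_i)+u(p_j))+2u(p_k)}{(2-\lambda_{m+1})(5-\lambda_{m+1})},\quad \{i,j,k\}=\{0,1,2\},$$ where $p_{ij}$ is the midpoint of the edge joining $p_i,p_j$. Edges. For an $m$-edge $E$, let $p_0^E,p_1^E$ be its endpoints (in a fixed order) and $p_{01}^E$ its midpoint. For $f$ non-constant on $E$, $r^E(f)=\frac{f(p_1^E)-f(p_{01}^E)}{f(p_{01}^E)-f(p_0^E)}\in\mathbb{R}\cup\{\infty\}$, equal to $\infty$ (a single point at infinity) when $f(p_{01}^E)=f(p_0^E)$. Let $\phi_i^E(x)=\frac12(x-p_i^E)+p_i^E$,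 $i=0,1$, and for $\tau=\tau_1\cdots\tau_l$ with $\tau_i\in\{0,1\}$ let $E_\tau=\phi^E_{\tau_1}\circ\cdots\circ\phi^E_{\tau_l}(E)$, an $(m+l)$-edge with endpoints $p_i^{E_\tau}=\phi^E_{\tau_1}\circ\cdots\circ\phi^E_{\tau_l}(p_i^E)$. $0^l$, $1^l$ are the words of $l$ zeros, resp. ones. "Extremum" of $f|_E$ means a local extremum of $f|_E$ at a point of $E$ other than its endpoints; "a single extremum" means exactly one. *)

theory Defs
  imports "HOL-Analysis.Analysis"
begin

type_synonym plane = "real ^ 2"

text \<open>The contractions and their compositions along words are parametrised by a family of
  fixed points \<open>p\<close>.  They serve both for the gasket (\<open>p = q\<close>, letters \<open>0, 1, 2\<close>) and for an
  edge with endpoints \<open>e 0\<close>, \<open>e 1\<close> (\<open>p = e\<close>, letters \<open>0, 1\<close>).\<close>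

definition contraction :: "(nat \<Rightarrow> plane) \<Rightarrow> nat \<Rightarrow> plane \<Rightarrow> plane" where
  "contraction p i x = (1/2) *\<^sub>R (x - p i) + p i"

definition word_map :: "(nat \<Rightarrow> plane) \<Rightarrow> nat list \<Rightarrow> plane \<Rightarrow> plane" where
  "word_map p w = foldr (\<lambda>i g. contraction p i \<circ> g) w id"


definition equilateral :: "(nat \<Rightarrow> plane) \<Rightarrow> bool" where
  "equilateral q \<longleftrightarrow> q 0 \<noteq> q 1 \<and> dist (q 0) (q 1) = dist (q 1) (q 2)
     \<and> dist (q 1) (q 2) = dist (q 2) (q 0)"

definition SG :: "(nat \<Rightarrow> plane) \<Rightarrow> plane set" where
  "SG q = (THE K. compact K \<and> K \<noteq> {} \<and> K = (\<Union>i<3. contraction q i ` K))"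

primrec V :: "(nat \<Rightarrow> plane) \<Rightarrow> nat \<Rightarrow> plane set" where
  "V q 0 = {q 0, q 1, q 2}"
| "V q (Suc m) = (\<Union>i<3. contraction q i ` V q m)"

definition adj :: "(nat \<Rightarrow> plane) \<Rightarrow> nat \<Rightarrow> plane \<Rightarrow> plane \<Rightarrow> bool" where
  "adj q m x y \<longleftrightarrow> x \<noteq> y \<and>
     (\<exists>w. length w = m \<and> set w \<subseteq> {..<3} \<and> {x, y} \<subseteq> word_map q w ` V q 0)"

definition graph_laplacian :: "(nat \<Rightarrow> plane) \<Rightarrow> nat \<Rightarrow> (plane \<Rightarrow> real) \<Rightarrow> plane \<Rightarrow> real" where
  "graph_laplacian q m u x = (\<Sum>y | adj q m x y. u y - u x)"

text \<open>\<open>has_laplacian q u f\<close>: \<open>u\<close> is in the domain of the Laplacian and its Laplacian is \<open>f\<close>.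
  The \<open>m\<close>-th graph Laplacian only makes sense at points of \<open>V q m\<close>, so uniform convergence on
  the union of all \<open>V q m - V q 0\<close> compares the \<open>m\<close>-th term with \<open>f\<close> on \<open>V q m - V q 0\<close>.\<close>

definition has_laplacian :: "(nat \<Rightarrow> plane) \<Rightarrow> (plane \<Rightarrow> real) \<Rightarrow> (plane \<Rightarrow> real) \<Rightarrow> bool" where
  "has_laplacian q u f \<longleftrightarrow> continuous_on (SG q) u \<and> continuous_on (SG q) f \<and>
     (\<forall>\<epsilon>>0. \<exists>M. \<forall>m\<ge>M. \<forall>x\<in>V q m - V q 0.
        \<bar>3/2 * 5 ^ m * graph_laplacian q m u x - f x\<bar> < \<epsilon>)"

definition eigenfunction :: "(nat \<Rightarrow> plane) \<Rightarrow> (plane \<Rightarrow> real) \<Rightarrow> real \<Rightarrow> bool" where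
  "eigenfunction q u \<Lambda> \<longleftrightarrow> (\<exists>x\<in>SG q. u x \<noteq> 0) \<and>
     (\<exists>f. has_laplacian q u f \<and> (\<forall>x\<in>SG q. - f x = \<Lambda> * u x))"

datatype boundary_cond = Dirichlet | Neumann

definition vanishing_normal_deriv :: "(nat \<Rightarrow> plane) \<Rightarrow> (plane \<Rightarrow> real) \<Rightarrow> nat \<Rightarrow> bool" where
  "vanishing_normal_deriv q u i \<longleftrightarrow>
     (\<lambda>m. (5/3) ^ m * (\<Sum>j\<in>{..<3} - {i}. u (q i) - u ((contraction q i ^^ m) (q j))))
       \<longlonglongrightarrow> 0"

definition satisfies_bc :: "(nat \<Rightarrow> plane) \<Rightarrow> boundary_cond \<Rightarrow> (plane \<Rightarrow> real) \<Rightarrow> bool" where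
  "satisfies_bc q bc u \<longleftrightarrow> (case bc of
       Dirichlet \<Rightarrow> \<forall>i<3. u (q i) = 0
     | Neumann \<Rightarrow> \<forall>i<3. vanishing_normal_deriv q u i)"


text \<open>In the Neumann case the equation at a boundary vertex is the one obtained by even
  reflection, which doubles its neighbours.\<close>

definition graph_eigenfunction ::
    "(nat \<Rightarrow> plane) \<Rightarrow> boundary_cond \<Rightarrow> nat \<Rightarrow> (plane \<Rightarrow> real) \<Rightarrow> real \<Rightarrow> bool" where
  "graph_eigenfunction q bc m u \<mu> \<longleftrightarrow> (\<exists>x\<in>V q m. u x \<noteq> 0) \<and>
     (\<forall>x\<in>V q m - V q 0. - graph_laplacian q m u x = \<mu> * u x) \<and>
     (case bc of
        Dirichlet \<Rightarrow> \<forall>i<3. u (q i) = 0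
      | Neumann \<Rightarrow> \<forall>i<3. 2 * (\<Sum>y | adj q m (q i) y. u (q i) - u y) = \<mu> * u (q i))"

definition decimates_from ::
    "(nat \<Rightarrow> plane) \<Rightarrow> boundary_cond \<Rightarrow> (plane \<Rightarrow> real) \<Rightarrow> real \<Rightarrow> (nat \<Rightarrow> real) \<Rightarrow> nat \<Rightarrow> bool" where
  "decimates_from q bc u \<Lambda> lam n \<longleftrightarrow>
     (\<forall>m\<ge>n. graph_eigenfunction q bc m u (lam m)
        \<and> lam m = lam (Suc m) * (5 - lam (Suc m))) \<and>
     (\<lambda>m. 3/2 * (5 ^ m * lam m)) \<longlonglongrightarrow> \<Lambda>"

text \<open>\<open>spectral_data q bc u \<Lambda> lam m0\<close>: \<open>m0\<close> is the level of birth of \<open>u\<close> and \<open>lam m\<close>, for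
  \<open>m \<ge> m0\<close>, are its graph eigenvalues; the values \<open>lam m\<close> with \<open>m < m0\<close> are irrelevant.\<close>

definition spectral_data ::
    "(nat \<Rightarrow> plane) \<Rightarrow> boundary_cond \<Rightarrow> (plane \<Rightarrow> real) \<Rightarrow> real \<Rightarrow> (nat \<Rightarrow> real) \<Rightarrow> nat \<Rightarrow> bool" where
  "spectral_data q bc u \<Lambda> lam m0 \<longleftrightarrow> decimates_from q bc u \<Lambda> lam m0 \<and>
     (\<forall>n lam'. decimates_from q bc u \<Lambda> lam' n \<longrightarrow> m0 \<le> n)"

definition epsilon_sequence :: "(nat \<Rightarrow> real) \<Rightarrow> nat \<Rightarrow> (nat \<Rightarrow> real) \<Rightarrow> bool" where
  "epsilon_sequence lam m0 eps \<longleftrightarrow> (\<forall>m\<ge>m0. eps (Suc m) \<in> {-1, 1} \<and>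
     lam (Suc m) = (5 + eps (Suc m) * sqrt (25 - 4 * lam m)) / 2)"

definition level_of_fixation :: "nat \<Rightarrow> (nat \<Rightarrow> real) \<Rightarrow> nat \<Rightarrow> bool" where
  "level_of_fixation m0 eps m1 \<longleftrightarrow> m0 < m1 \<and> (\<forall>m\<ge>m1. eps m = -1) \<and>
     (\<forall>n>m0. (\<forall>m\<ge>n. eps m = -1) \<longrightarrow> m1 \<le> n)"


text \<open>An edge is given by its ordered endpoints \<open>e 0\<close>, \<open>e 1\<close>.\<close>

definition is_edge :: "(nat \<Rightarrow> plane) \<Rightarrow> nat \<Rightarrow> (nat \<Rightarrow> plane) \<Rightarrow> plane set \<Rightarrow> bool" where
  "is_edge q m e E \<longleftrightarrow> adj q m (e 0) (e 1) \<and> E = closed_segment (e 0) (e 1)"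

text \<open>The ratio lives in the reals with one point at infinity, represented by \<open>\<infinity> :: ereal\<close>;
  the value \<open>-\<infinity>\<close> is never taken.\<close>

definition edge_ratio :: "(nat \<Rightarrow> plane) \<Rightarrow> (plane \<Rightarrow> real) \<Rightarrow> ereal" where
  "edge_ratio e f = (let c = midpoint (e 0) (e 1) in
     if f c = f (e 0) then \<infinity> else ereal ((f (e 1) - f c) / (f c - f (e 0))))"

definition strictly_monotone_on_edge :: "(nat \<Rightarrow> plane) \<Rightarrow> (plane \<Rightarrow> real) \<Rightarrow> bool" where
  "strictly_monotone_on_edge e f \<longleftrightarrow>
     strict_mono_on {0..1} (f \<circ> linepath (e 0) (e 1)) \<or>
     strict_antimono_on {0..1} (f \<circ> linepath (e 0) (e 1))"

definition local_extremum_on :: "plane set \<Rightarrow> (plane \<Rightarrow> real) \<Rightarrow> plane \<Rightarrow> bool" where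
  "local_extremum_on E f x \<longleftrightarrow> x \<in> E \<and>
     ((\<forall>\<^sub>F y in at x within E. f y \<le> f x) \<or> (\<forall>\<^sub>F y in at x within E. f y \<ge> f x))"

definition single_extremum_on_edge :: "(nat \<Rightarrow> plane) \<Rightarrow> (plane \<Rightarrow> real) \<Rightarrow> bool" where
  "single_extremum_on_edge e f \<longleftrightarrow>
     (\<exists>!x. x \<notin> {e 0, e 1} \<and> local_extremum_on (closed_segment (e 0) (e 1)) f x)"

definition sub_endpoint :: "(nat \<Rightarrow> plane) \<Rightarrow> nat list \<Rightarrow> nat \<Rightarrow> plane" where
  "sub_endpoint e \<tau> i = word_map e \<tau> (e i)"

text \<open>The limits \<open>\<alpha>\<close> and \<open>\<beta>\<close>, as relations so that existence of the limit in \<open>[0, \<infinity>]\<close> is part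
  of the assertion that it has a given value.\<close>

definition has_alpha :: "(nat \<Rightarrow> plane) \<Rightarrow> (plane \<Rightarrow> real) \<Rightarrow> ereal \<Rightarrow> bool" where
  "has_alpha e f a \<longleftrightarrow>
     (\<lambda>l. ereal (\<bar>f (sub_endpoint e (replicate l 0) 1) - f (e 0)\<bar> /
                 norm (sub_endpoint e (replicate l 0) 1 - e 0))) \<longlonglongrightarrow> a"

definition has_beta :: "(nat \<Rightarrow> plane) \<Rightarrow> (plane \<Rightarrow> real) \<Rightarrow> ereal \<Rightarrow> bool" where
  "has_beta e f b \<longleftrightarrow>
     (\<lambda>l. ereal (\<bar>f (sub_endpoint e (replicate l 1) 0) - f (e 1)\<bar> /
                 norm (sub_endpoint e (replicate l 1) 0 - e 1))) \<longlonglongrightarrow> b"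

end

theory Submission
  imports Defs
begin

text \<open>
  Along an edge the eigenvalue equations close up, so that the behaviour of the eigenfunction on
  the edge is decided by two numbers.  Let an \<open>m\<close>-edge carry the endpoint values \<open>x0\<close>, \<open>x1\<close> and
  the midpoint value \<open>y\<close>, let \<open>\<mu>\<close> and \<open>t\<close> be the graph eigenvalues of levels \<open>m + 1\<close> and
  \<open>m + 2\<close>, so \<open>\<mu> = t (5 - t)\<close>, and put
  \<open>L = (4 - \<mu>) (y - x0) - (x1 - y)\<close> and \<open>R = (4 - \<mu>) (x1 - y) - (y - x0)\<close>.
  The equations at the midpoints of the surrounding cell and of its subcells contain values off
  the edge.  Eliminating these leaves, with \<open>c = (3 - t) / (5 - \<mu>)\<close>,
  \<open>L' = c L\<close> and \<open>R' = c (x1 - x0)\<close> on the half at \<open>x0\<close>, and \<open>L'' = c (x1 - x0)\<close> and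
  \<open>R'' = c R\<close> on the half at \<open>x1\<close>, while \<open>L + R = (3 - \<mu>) (x1 - x0)\<close>
  (lemma \<open>edge_slope_recursion\<close>; the second half is the first half of the reversed edge).

  From the level of fixation on the smaller root of the quadratic equation is taken, hence
  \<open>\<mu> \<le> 5/2\<close> and \<open>c > 0\<close>.  The theorem follows from the signs of \<open>L\<close> and \<open>R\<close> alone.

  \<^item> If \<open>L, R \<ge> 0\<close> do not both vanish, then \<open>x1 > x0\<close>, and both halves inherit the
    hypothesis.  So all dyadic increments are positive and the function is strictly increasing
    (\<open>strictly_increasing\<close>).  If \<open>L = R = 0\<close> it is constant.

  \<^item> If \<open>L > 0 > R\<close>, then one half is again of this kind and the function is strictly monotone on
    the other one, increasing to the left or decreasing to the right; or \<open>x0 = x1\<close> and both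
    halves are monotone.  Bisection gives a unimodal function (\<open>unimodal\<close>).

  \<^item> Near an endpoint, \<open>L\<close> on the edge of length \<open>2^-l\<close> is multiplied by factors \<open>c\<close> that tend to
    \<open>3/5 > 1/2\<close>.  If \<open>L \<noteq> 0\<close> the difference quotient therefore blows up
    (\<open>abs_scaled_increment_at_top\<close>).  If \<open>L = 0\<close> the increments themselves are multiplied by
    \<open>1 / (5 - \<mu>) \<le> 2/5 < 1/2\<close>, and the quotient tends to \<open>0\<close> (\<open>scaled_increment_tendsto_0\<close>).

  Finally, \<open>r = (x1 - y) / (y - x0)\<close> equals \<open>4 - \<mu>\<close> exactly if \<open>L = 0\<close>, equals
  \<open>1 / (4 - \<mu>)\<close> exactly if \<open>R = 0\<close>, and lies between the two exactly if \<open>L\<close> and \<open>R\<close> do not have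
  opposite signs.

  The recursion needs the neighbours of a midpoint in the graph approximation
  (\<open>midpoint_neighbours\<close>), and passing from dyadic points to the whole edge needs that edges lie
  in the gasket (\<open>edge_subset_SG\<close>), where the eigenfunction is continuous.
\<close>

section \<open>Monotonicity and unimodality from dyadic points\<close>

text \<open>Every point \<open>z\<close> is the limit of the grid points \<open>\<lfloor>z 2^l\<rfloor> / 2^l\<close>, and rounding
  down preserves the order, so monotonicity on all dyadic grids passes to the limit.\<close>

lemma mono_on_if_dyadic_increments_nonneg:
  fixes f :: "real \<Rightarrow> real"
  assumes cont: "continuous_on {0..1} f"
    and inc: "\<And>l j. j < 2 ^ l \<Longrightarrow> f (real j / 2 ^ l) \<le> f ((real j + 1) / 2 ^ l)"
  shows "mono_on {0..1} f"
proof (rule mono_onI)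
  fix x y :: real
  assume x: "x \<in> {0..1}" and y: "y \<in> {0..1}" and xy: "x \<le> y"
  define g where "g = (\<lambda>(z::real) (l::nat). real (nat \<lfloor>z * 2 ^ l\<rfloor>) / 2 ^ l)"
  have grid: "i \<le> j \<Longrightarrow> j \<le> 2 ^ l \<Longrightarrow> f (real i / 2 ^ l) \<le> f (real j / 2 ^ l)" for i j l
  proof (induction j rule: dec_induct)
    case (step j)
    then show ?case using inc[of j l] by (simp add: add.commute)
  qed simp
  have lim: "(\<lambda>l. f (g z l)) \<longlonglongrightarrow> f z" if z: "z \<in> {0..1}" for z
  proof -
    have fl: "real (nat \<lfloor>z * 2 ^ l\<rfloor>) = of_int \<lfloor>z * 2 ^ l\<rfloor>" for l
      using z by simp
    have up: "g z l \<le> z" for l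
      unfolding g_def fl by (simp add: pos_divide_le_eq)
    have low: "z - (1/2) ^ l \<le> g z l" for l
    proof -
      have "z * 2 ^ l - 1 \<le> of_int \<lfloor>z * 2 ^ l\<rfloor>" by linarith
      then have "(z * 2 ^ l - 1) / 2 ^ l \<le> g z l"
        unfolding g_def fl by (intro divide_right_mono) auto
      then show ?thesis by (simp add: diff_divide_distrib power_one_over)
    qed
    have "(\<lambda>l. z - (1/2::real) ^ l) \<longlonglongrightarrow> z - 0"
      by (intro tendsto_intros LIMSEQ_realpow_zero) auto
    then have "(\<lambda>l. g z l) \<longlonglongrightarrow> z"
      by (intro tendsto_sandwich[of "\<lambda>l. z - (1/2) ^ l" "g z" sequentially "\<lambda>_. z"])
        (use up low in auto)
    moreover have "g z l \<in> {0..1}" for l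
    proof -
      have "0 \<le> g z l" by (simp add: g_def)
      then show ?thesis using up[of l] z by auto
    qed
    ultimately show ?thesis
      by (intro continuous_on_tendsto_compose[OF cont _ z]) auto
  qed
  have "f (g x l) \<le> f (g y l)" for l
  proof -
    have "nat \<lfloor>x * 2 ^ l\<rfloor> \<le> nat \<lfloor>y * 2 ^ l\<rfloor>"
      using xy by (intro nat_mono floor_mono mult_right_mono) auto
    moreover have "nat \<lfloor>y * 2 ^ l\<rfloor> \<le> 2 ^ l"
    proof -
      have "y * 2 ^ l \<le> 1 * 2 ^ l" using y by (intro mult_right_mono) auto
      then have "\<lfloor>y * 2 ^ l\<rfloor> \<le> \<lfloor>1 * 2 ^ l :: real\<rfloor>" by (rule floor_mono)
      then show ?thesis by (simp add: nat_le_iff)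
    qed
    ultimately show ?thesis unfolding g_def by (rule grid)
  qed
  then show "f x \<le> f y"
    using LIMSEQ_le[OF lim[OF x] lim[OF y]] by blast
qed

text \<open>Between two points there is a complete dyadic interval, on which the function gains a
  positive amount; elsewhere it does not decrease.\<close>

lemma strict_mono_on_if_dyadic_increments_pos:
  fixes f :: "real \<Rightarrow> real"
  assumes cont: "continuous_on {0..1} f"
    and inc: "\<And>l j. j < 2 ^ l \<Longrightarrow> f (real j / 2 ^ l) < f ((real j + 1) / 2 ^ l)"
  shows "strict_mono_on {0..1} f"
proof (rule strict_mono_onI)
  fix x y :: real
  assume x: "x \<in> {0..1}" and y: "y \<in> {0..1}" and xy: "x < y"
  have mono: "mono_on {0..1} f"
    using mono_on_if_dyadic_increments_nonneg[OF cont] inc by (simp add: less_imp_le)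
  obtain l where l: "(1/2::real) ^ l < (y - x) / 2"
    using real_arch_pow_inv[of "(y - x) / 2" "1/2"] xy by auto
  define j where "j = nat \<lceil>x * 2 ^ l\<rceil>"
  have j: "real j = of_int \<lceil>x * 2 ^ l\<rceil>" using x by (simp add: j_def)
  have "x * 2 ^ l \<le> real j" "real j < x * 2 ^ l + 1" unfolding j by linarith+
  then have jx: "x \<le> real j / 2 ^ l" and "real j + 1 \<le> x * 2 ^ l + 2"
    by (auto simp: pos_le_divide_eq)
  then have "(real j + 1) / 2 ^ l \<le> (x * 2 ^ l + 2) / 2 ^ l" by (intro divide_right_mono) auto
  also have "\<dots> = x + 2 * (1/2) ^ l" by (simp add: add_divide_distrib power_one_over)
  also have "\<dots> < y" using l by simp
  finally have jy: "(real j + 1) / 2 ^ l < y" .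
  from y have "y \<le> 1" by simp
  with jy have jy1: "(real j + 1) / 2 ^ l < 1" by linarith
  then have "real j + 1 < 2 ^ l" by (simp add: pos_divide_less_eq)
  then have "real j < 2 ^ l" by linarith
  then have "j < 2 ^ l" by (metis of_nat_less_iff of_nat_numeral of_nat_power)
  then have "f (real j / 2 ^ l) < f ((real j + 1) / 2 ^ l)" by (rule inc)
  moreover have "f x \<le> f (real j / 2 ^ l)"
    using \<open>real j < 2 ^ l\<close> x jx by (intro mono_onD[OF mono]) (auto simp: pos_divide_le_eq)
  moreover have "f ((real j + 1) / 2 ^ l) \<le> f y"
    using jy jy1 y by (intro mono_onD[OF mono]) (auto simp del: divide_le_eq_1_pos)
  ultimately show "f x < f y" by linarith
qed

lemma strict_mono_on_glue:
  fixes f :: "real \<Rightarrow> real"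
  assumes "strict_mono_on {a..b} f" "strict_mono_on {b..c} f"
  shows "strict_mono_on {a..c} f"
proof (rule strict_mono_onI)
  fix x y assume "x \<in> {a..c}" "y \<in> {a..c}" "x < y"
  then consider "y \<le> b" | "x \<ge> b" | "x < b" "b < y" by linarith
  then show "f x < f y"
  proof cases
    case 3
    then have "f x < f b" "f b < f y"
      using \<open>x \<in> {a..c}\<close> \<open>y \<in> {a..c}\<close> strict_mono_onD[OF assms(1), of x b]
        strict_mono_onD[OF assms(2), of b y] by auto
    then show ?thesis by simp
  qed (use \<open>x \<in> {a..c}\<close> \<open>y \<in> {a..c}\<close> \<open>x < y\<close> assms in \<open>auto simp: strict_mono_on_def\<close>)
qed

lemma strict_antimono_on_iff_uminus:
  fixes f :: "real \<Rightarrow> real"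
  shows "strict_antimono_on A f \<longleftrightarrow> strict_mono_on A (\<lambda>x. - f x)"
  by (simp add: monotone_on_def)

lemma strict_antimono_on_glue:
  fixes f :: "real \<Rightarrow> real"
  assumes "strict_antimono_on {a..b} f" "strict_antimono_on {b..c} f"
  shows "strict_antimono_on {a..c} f"
  using strict_mono_on_glue assms unfolding strict_antimono_on_iff_uminus by blast

text \<open>The two maps \<open>x \<mapsto> (x + t) / 2\<close>, \<open>t = 0, 1\<close>, carry \<open>[0, 1]\<close> onto its halves; the lemma
  moves monotonicity from a rescaled half back to that half.\<close>

lemma strict_mono_on_affine:
  fixes f :: "real \<Rightarrow> real"
  assumes "strict_mono_on {a..b} (\<lambda>x. f ((x + t) / 2))"
  shows "strict_mono_on {(a + t) / 2..(b + t) / 2} f"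
proof (rule strict_mono_onI)
  fix x y assume "x \<in> {(a + t) / 2..(b + t) / 2}" "y \<in> {(a + t) / 2..(b + t) / 2}" "x < y"
  then have "f ((2 * x - t + t) / 2) < f ((2 * y - t + t) / 2)"
    by (intro strict_mono_onD[OF assms]) auto
  then show "f x < f y" by simp
qed

lemma strict_antimono_on_affine:
  fixes f :: "real \<Rightarrow> real"
  assumes "strict_antimono_on {a..b} (\<lambda>x. f ((x + t) / 2))"
  shows "strict_antimono_on {(a + t) / 2..(b + t) / 2} f"
  using strict_mono_on_affine[of a b "\<lambda>x. - f x"] assms
  unfolding strict_antimono_on_iff_uminus by blast

lemma strict_mono_on_closed_right:
  fixes f :: "real \<Rightarrow> real"
  assumes cont: "continuous_on {a..c} f"
    and mono: "\<And>b. a \<le> b \<Longrightarrow> b < c \<Longrightarrow> strict_mono_on {a..b} f"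
  shows "strict_mono_on {a..c} f"
proof (rule strict_mono_onI)
  fix x y assume x: "x \<in> {a..c}" and y: "y \<in> {a..c}" and xy: "x < y"
  show "f x < f y"
  proof (cases "y < c")
    case True
    then show ?thesis using strict_mono_onD[OF mono[of y], of x y] x y xy by auto
  next
    case False
    define z where "z = (x + y) / 2"
    have z: "x < z" "z < c" "a \<le> z" "y = c" using False x y xy by (auto simp: z_def)
    have "f x < f z" using strict_mono_onD[OF mono[of z], of x z] x z by auto
    moreover have "f z \<le> f y"
    proof (rule tendsto_lowerbound)
      show "(f \<longlongrightarrow> f y) (at c within {a..c})"
        using cont z(4) y by (auto simp: continuous_on)
      show "\<forall>\<^sub>F w in at c within {a..c}. f z \<le> f w"
      proof -
        have "\<forall>\<^sub>F w in at c within {a..c}. w > z"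
          using z(2) by (intro order_tendstoD(1)[OF tendsto_ident_at]) 
        moreover have "\<forall>\<^sub>F w in at c within {a..c}. w \<in> {a..c} \<and> w \<noteq> c"
          by (auto simp: eventually_at_filter)
        ultimately show ?thesis
          by eventually_elim (use strict_mono_onD[OF mono, of _ z] z in \<open>force intro: less_imp_le\<close>)
      qed
      show "at c within {a..c} \<noteq> bot"
        using z by (auto simp: trivial_limit_within islimpt_Icc)
    qed
    ultimately show ?thesis by simp
  qed
qed

lemma reflect_strict_mono:
  fixes f :: "real \<Rightarrow> real"
  shows "strict_mono_on {a..b} f \<longleftrightarrow> strict_antimono_on {1 - b..1 - a} (\<lambda>x. f (1 - x))"
proof
  assume "strict_mono_on {a..b} f"
  then show "strict_antimono_on {1 - b..1 - a} (\<lambda>x. f (1 - x))"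
    by (auto simp: monotone_on_def)
next
  assume *: "strict_antimono_on {1 - b..1 - a} (\<lambda>x. f (1 - x))"
  show "strict_mono_on {a..b} f"
  proof (rule strict_mono_onI)
    fix r s assume "r \<in> {a..b}" "s \<in> {a..b}" "r < s"
    then show "f r < f s" using *[unfolded monotone_on_def, rule_format, of "1 - s" "1 - r"] by simp
  qed
qed

text \<open>The turning point is the supremum \<open>c\<close> of the left ends \<open>a\<close>: the function increases
  strictly below every \<open>x < c\<close> and decreases strictly above every \<open>x > c\<close>, and continuity adds
  the point \<open>c\<close> itself.\<close>

lemma unimodal_if_approximately_unimodal:
  fixes f :: "real \<Rightarrow> real"
  assumes cont: "continuous_on {0..1} f"
    and approx: "\<And>n::nat. \<exists>a b. 0 \<le> a \<and> a \<le> b \<and> b \<le> 1 \<and> b - a \<le> 1 / 2 ^ n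
        \<and> strict_mono_on {0..a} f \<and> strict_antimono_on {b..1} f"
  obtains c where "c \<in> {0..1}" "strict_mono_on {0..c} f" "strict_antimono_on {c..1} f"
proof -
  obtain a b where ab: "\<And>n::nat. 0 \<le> a n \<and> a n \<le> b n \<and> b n \<le> 1 \<and> b n - a n \<le> 1 / 2 ^ n
        \<and> strict_mono_on {0..a n} f \<and> strict_antimono_on {b n..1} f"
    using approx by metis
  define c where "c = (SUP n. a n)"
  have bdd: "bdd_above (range a)" using ab by (meson bdd_aboveI2 order_trans)
  have ac: "a n \<le> c" for n unfolding c_def by (rule cSUP_upper[OF _ bdd]) simp
  have c1: "c \<le> 1" unfolding c_def by (rule cSUP_least) (use ab in \<open>auto intro: order_trans\<close>)
  have c0: "0 \<le> c" using ab[of 0] ac[of 0] by linarith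
  have mono: "strict_mono_on {0..x} f" if x: "x < c" for x
  proof -
    obtain n where "x < a n" using x unfolding c_def by (auto simp: less_cSUP_iff[OF UNIV_not_empty bdd])
    then show ?thesis using ab[of n] by (auto intro: monotone_on_subset)
  qed
  have anti: "strict_antimono_on {x..1} f" if x: "c < x" for x
  proof -
    obtain n where "(1/2::real) ^ n < x - c"
      using real_arch_pow_inv[of "x - c" "1/2"] x by auto
    then have "b n \<le> x" using ab[of n] ac[of n] by (simp add: power_one_over)
    then show ?thesis using ab[of n] by (auto intro: monotone_on_subset)
  qed
  show thesis
  proof
    show "c \<in> {0..1}" using c0 c1 by simp
    show "strict_mono_on {0..c} f"
      by (rule strict_mono_on_closed_right[OF continuous_on_subset[OF cont] mono]) (use c1 in auto)
    have "strict_mono_on {0..1 - c} (\<lambda>x. f (1 - x))"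
    proof (rule strict_mono_on_closed_right)
      show "continuous_on {0..1 - c} (\<lambda>x. f (1 - x))"
        by (rule continuous_on_compose2[OF cont]) (use c0 in \<open>auto intro!: continuous_intros\<close>)
      show "strict_mono_on {0..b} (\<lambda>x. f (1 - x))" if "b < 1 - c" for b
        using anti[of "1 - b"] that by (subst reflect_strict_mono) simp
    qed
    then show "strict_antimono_on {c..1} f" by (subst (asm) reflect_strict_mono) simp
  qed
qed

section \<open>Edge families\<close>

text \<open>Corrected slopes at the two ends of an edge: each is the combination of the two
  half-increments that is merely rescaled when the edge is replaced by its half at that end.  The
  parameter is the graph eigenvalue at the level of the midpoint.\<close>

definition left_slope :: "real \<Rightarrow> (real \<Rightarrow> real) \<Rightarrow> real" where
  "left_slope \<mu> f = (4 - \<mu>) * (f (1/2) - f 0) - (f 1 - f (1/2))"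

definition right_slope :: "real \<Rightarrow> (real \<Rightarrow> real) \<Rightarrow> real" where
  "right_slope \<mu> f = (4 - \<mu>) * (f 1 - f (1/2)) - (f (1/2) - f 0)"

definition scaled_increment :: "(real \<Rightarrow> real) \<Rightarrow> nat \<Rightarrow> real" where
  "scaled_increment f l = 2 ^ l * (f (1 / 2 ^ l) - f 0)"

text \<open>The restrictions of an eigenfunction to edges, parametrised by \<open>[0, 1]\<close>: \<open>P n f\<close> says that \<open>f\<close>
  is such a restriction, up to a constant factor, \<open>n\<close> levels below the starting level, and \<open>\<mu> n\<close> is the graph eigenvalue one
  level further down, which governs the midpoint of that edge.  Closure under negation and
  reversal of the edge reduces every statement to one sign and one end.\<close>

locale edge_family =
  fixes P :: "nat \<Rightarrow> (real \<Rightarrow> real) \<Rightarrow> bool" and \<mu> :: "nat \<Rightarrow> real"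
  assumes eigenvalue_le: "\<mu> n \<le> 5/2"
    and eigenvalue_lim: "\<mu> \<longlonglongrightarrow> 0"
    and continuous: "P n f \<Longrightarrow> continuous_on {0..1} f"
    and negate: "P n f \<Longrightarrow> P n (\<lambda>x. - f x)"
    and reflect: "P n f \<Longrightarrow> P n (\<lambda>x. f (1 - x))"
    and left_half: "P n f \<Longrightarrow> P (Suc n) (\<lambda>x. f (x / 2))"
    and left_slope_left_half: "P n f \<Longrightarrow> left_slope (\<mu> (Suc n)) (\<lambda>x. f (x / 2))
          = (3 - \<mu> (Suc n)) / (5 - \<mu> n) * left_slope (\<mu> n) f"
    and right_slope_left_half: "P n f \<Longrightarrow> right_slope (\<mu> (Suc n)) (\<lambda>x. f (x / 2))
          = (3 - \<mu> (Suc n)) / (5 - \<mu> n) * (f 1 - f 0)"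
begin

abbreviation L :: "nat \<Rightarrow> (real \<Rightarrow> real) \<Rightarrow> real" where
  "L n f \<equiv> left_slope (\<mu> n) f"

abbreviation R :: "nat \<Rightarrow> (real \<Rightarrow> real) \<Rightarrow> real" where
  "R n f \<equiv> right_slope (\<mu> n) f"

definition slope_factor :: "nat \<Rightarrow> real" where
  "slope_factor n = (3 - \<mu> (Suc n)) / (5 - \<mu> n)"

lemmas L_left_half = left_slope_left_half[folded slope_factor_def]
  and R_left_half = right_slope_left_half[folded slope_factor_def]

lemma slope_factor_pos: "slope_factor n > 0"
  using eigenvalue_le[of n] eigenvalue_le[of "Suc n"] by (simp add: slope_factor_def)

text \<open>This identity couples the two ends: the total increment of an edge is a positive multiple of
  the sum of its end slopes, so their signs control it.\<close>

lemma L_plus_R: "L n f + R n f = (3 - \<mu> n) * (f 1 - f 0)"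
  by (simp add: left_slope_def right_slope_def algebra_simps)

lemma increment_eq: "f 1 - f 0 = (L n f + R n f) / (3 - \<mu> n)"
  using eigenvalue_le[of n] by (simp add: L_plus_R)

lemma increment_pos:
  assumes "L n f \<ge> 0" "R n f \<ge> 0" "L n f \<noteq> 0 \<or> R n f \<noteq> 0"
  shows "f 1 - f 0 > 0"
proof -
  have "L n f + R n f > 0" using assms by linarith
  then show ?thesis
    unfolding increment_eq[of f n] using eigenvalue_le[of n] by (intro divide_pos_pos) auto
qed

lemma L_negate: "L n (\<lambda>x. - f x) = - L n f"
  and R_negate: "R n (\<lambda>x. - f x) = - R n f"
  by (simp_all add: left_slope_def right_slope_def algebra_simps)

lemma L_reflect: "L n (\<lambda>x. f (1 - x)) = - R n f"
  and R_reflect: "R n (\<lambda>x. f (1 - x)) = - L n f"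
  by (simp_all add: left_slope_def right_slope_def algebra_simps)

text \<open>The right half is the left half of the reversed edge.\<close>

lemma right_half: "P n f \<Longrightarrow> P (Suc n) (\<lambda>x. f ((x + 1) / 2))"
  and L_right_half: "P n f \<Longrightarrow> L (Suc n) (\<lambda>x. f ((x + 1) / 2)) = slope_factor n * (f 1 - f 0)"
  and R_right_half: "P n f \<Longrightarrow> R (Suc n) (\<lambda>x. f ((x + 1) / 2)) = slope_factor n * R n f"
proof -
  assume P: "P n f"
  have eq: "(\<lambda>x. f ((x + 1) / 2)) = (\<lambda>x. f (1 - (1 - x) / 2))" by (simp add: field_simps)
  show "P (Suc n) (\<lambda>x. f ((x + 1) / 2))"
    using reflect[OF left_half[OF reflect[OF P]]] unfolding eq .
  show "L (Suc n) (\<lambda>x. f ((x + 1) / 2)) = slope_factor n * (f 1 - f 0)"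
    using R_left_half[OF reflect[OF P]] unfolding eq
    by (subst L_reflect[of "Suc n" "\<lambda>x. f (1 - x / 2)"]) (simp add: algebra_simps)
  show "R (Suc n) (\<lambda>x. f ((x + 1) / 2)) = slope_factor n * R n f"
    using L_left_half[OF reflect[OF P]] unfolding eq
    by (subst R_reflect[of "Suc n" "\<lambda>x. f (1 - x / 2)"]) (simp add: L_reflect)
qed

text \<open>If both slopes are nonnegative, so is the total increment, and it supplies the new slope
  of either half at the point of division.  The hypothesis is therefore inherited by both halves.\<close>

lemma dyadic_increments_nonneg:
  assumes "P n f" "L n f \<ge> 0" "R n f \<ge> 0" "j < 2 ^ l"
  shows "f (real j / 2 ^ l) \<le> f ((real j + 1) / 2 ^ l)"
  using assms
proof (induction l arbitrary: n f j)
  case 0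
  then have "f 1 - f 0 \<ge> 0"
    unfolding increment_eq[of f n] using eigenvalue_le[of n] by simp
  then show ?case using 0 by simp
next
  case (Suc l)
  have inc: "f 1 - f 0 \<ge> 0"
    unfolding increment_eq[of f n] using eigenvalue_le[of n] Suc.prems by simp
  show ?case
  proof (cases "j < 2 ^ l")
    case True
    then show ?thesis
      using Suc.IH[OF left_half[OF Suc.prems(1)], of j] Suc.prems inc slope_factor_pos[of n]
      by (simp add: L_left_half R_left_half field_simps)
  next
    case False
    define i where "i = j - 2 ^ l"
    have i: "i < 2 ^ l" and j: "real j = real i + 2 ^ l"
      using False Suc.prems(4) by (simp_all add: i_def of_nat_diff)
    have "(real i / 2 ^ l + 1) / 2 = real j / 2 ^ Suc l"
      "((real i + 1) / 2 ^ l + 1) / 2 = (real j + 1) / 2 ^ Suc l"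
      by (simp_all add: j field_simps)
    moreover have "f ((real i / 2 ^ l + 1) / 2) \<le> f (((real i + 1) / 2 ^ l + 1) / 2)"
      using Suc.IH[OF right_half[OF Suc.prems(1)] _ _ i] Suc.prems inc slope_factor_pos[of n]
      by (simp add: L_right_half R_right_half)
    ultimately show ?thesis by (simp only:)
  qed
qed

text \<open>As soon as one of the nonnegative slopes is positive, so are the total increment and, on each half,
  the slope at the point of division.\<close>

lemma dyadic_increments_pos:
  assumes "P n f" "L n f \<ge> 0" "R n f \<ge> 0" "L n f \<noteq> 0 \<or> R n f \<noteq> 0" "j < 2 ^ l"
  shows "f (real j / 2 ^ l) < f ((real j + 1) / 2 ^ l)"
  using assms
proof (induction l arbitrary: n f j)
  case 0
  then show ?case using increment_pos[of n f] by simp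
next
  case (Suc l)
  have inc: "f 1 - f 0 > 0"
    using increment_pos Suc.prems(2-4) .
  show ?case
  proof (cases "j < 2 ^ l")
    case True
    then show ?thesis
      using Suc.IH[OF left_half[OF Suc.prems(1)], of j] Suc.prems inc slope_factor_pos[of n]
      by (simp add: L_left_half R_left_half field_simps)
  next
    case False
    define i where "i = j - 2 ^ l"
    have i: "i < 2 ^ l" and j: "real j = real i + 2 ^ l"
      using False Suc.prems(5) by (simp_all add: i_def of_nat_diff)
    have "(real i / 2 ^ l + 1) / 2 = real j / 2 ^ Suc l"
      "((real i + 1) / 2 ^ l + 1) / 2 = (real j + 1) / 2 ^ Suc l"
      by (simp_all add: j field_simps)
    moreover have "f ((real i / 2 ^ l + 1) / 2) < f (((real i + 1) / 2 ^ l + 1) / 2)"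
      using Suc.IH[OF right_half[OF Suc.prems(1)] _ _ _ i] Suc.prems inc slope_factor_pos[of n]
      by (simp add: L_right_half R_right_half)
    ultimately show ?thesis by (simp only:)
  qed
qed

theorem strictly_increasing:
  assumes "P n f" "L n f \<ge> 0" "R n f \<ge> 0" "L n f \<noteq> 0 \<or> R n f \<noteq> 0"
  shows "strict_mono_on {0..1} f"
  using strict_mono_on_if_dyadic_increments_pos[OF continuous[OF assms(1)]]
    dyadic_increments_pos[OF assms] by blast

theorem strictly_decreasing:
  assumes "P n f" "L n f \<le> 0" "R n f \<le> 0" "L n f \<noteq> 0 \<or> R n f \<noteq> 0"
  shows "strict_antimono_on {0..1} f"
  using strictly_increasing[OF negate[OF assms(1)]] assms(2-)
  by (simp add: strict_antimono_on_iff_uminus L_negate R_negate)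

text \<open>Vanishing slopes are nonnegative for \<open>f\<close> and for \<open>-f\<close>.\<close>

theorem constant_if_slopes_vanish:
  assumes "P n f" "L n f = 0" "R n f = 0" "x \<in> {0..1}"
  shows "f x = f 0"
proof -
  have *: "f 0 \<le> f x" if "P n f" "L n f = 0" "R n f = 0" for f
  proof -
    have "mono_on {0..1} f"
      using that dyadic_increments_nonneg[of n f]
      by (intro mono_on_if_dyadic_increments_nonneg continuous[OF that(1)]) auto
    then show ?thesis using assms(4) by (auto intro: mono_onD)
  qed
  show ?thesis
    using *[of f] *[of "\<lambda>x. - f x"] negate assms by (force simp: L_negate R_negate)
qed

text \<open>The left slope on the subedge of length \<open>2^-l\<close> at the left end, in the same scale as
  \<open>scaled_increment\<close>.\<close>

definition scaled_L :: "nat \<Rightarrow> (real \<Rightarrow> real) \<Rightarrow> nat \<Rightarrow> real" where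
  "scaled_L n f l = 2 ^ l * L (n + l) (\<lambda>x. f (x / 2 ^ l))"

lemma iterated_left_half: "P n f \<Longrightarrow> P (n + l) (\<lambda>x. f (x / 2 ^ l))"
proof (induction l)
  case (Suc l)
  then show ?case using left_half[OF Suc.IH[OF Suc.prems]] by (simp add: field_simps)
qed simp

lemma iterated_half_Suc: "(\<lambda>x. f ((x / 2) / 2 ^ l)) = (\<lambda>x::real. f (x / 2 ^ Suc l))"
  by (simp add: field_simps)

lemma scaled_L_0: "scaled_L n f 0 = L n f"
  by (simp add: scaled_L_def)

lemma scaled_L_Suc:
  assumes "P n f"
  shows "scaled_L n f (Suc l) = 2 * slope_factor (n + l) * scaled_L n f l"
  using L_left_half[OF iterated_left_half[OF assms, of l]]
  unfolding scaled_L_def iterated_half_Suc by simp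

text \<open>The increment of a left half is the sum of its slopes, \<open>c L\<close> and \<open>c\<close> times the old
  increment, divided by \<open>3\<close> minus the new eigenvalue; this denominator cancels the numerator of
  \<open>c\<close>.\<close>

lemma scaled_increment_Suc:
  assumes "P n f"
  shows "scaled_increment f (Suc l)
    = 2 / (5 - \<mu> (n + l)) * (scaled_L n f l + scaled_increment f l)"
proof -
  let ?g = "\<lambda>x. f (x / 2 ^ l)" and ?h = "\<lambda>x. f (x / 2 ^ Suc l)"
  have g: "P (n + l) ?g" by (rule iterated_left_half[OF assms])
  have "?h 1 - ?h 0 = (slope_factor (n + l) * L (n + l) ?g + slope_factor (n + l) * (?g 1 - ?g 0)) / (3 - \<mu> (Suc (n + l)))"
    using increment_eq[of ?h "Suc (n + l)"] L_left_half[OF g] R_left_half[OF g]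
    unfolding iterated_half_Suc by simp
  also have "\<dots> = (L (n + l) ?g + (?g 1 - ?g 0)) / (5 - \<mu> (n + l))"
  proof -
    have "3 - \<mu> (Suc (n + l)) \<noteq> 0" "5 - \<mu> (n + l) \<noteq> 0"
      using eigenvalue_le[of "Suc (n + l)"] eigenvalue_le[of "n + l"] by auto
    then show ?thesis by (simp add: slope_factor_def divide_simps) (simp add: algebra_simps)
  qed
  finally have "2 ^ Suc l * (?h 1 - ?h 0)
    = 2 ^ Suc l * ((L (n + l) ?g + (?g 1 - ?g 0)) / (5 - \<mu> (n + l)))" by (rule arg_cong)
  then show ?thesis
    by (simp add: scaled_increment_def scaled_L_def algebra_simps add_divide_distrib diff_divide_distrib)
qed

theorem scaled_increment_tendsto_0:
  assumes "P n f" "L n f = 0"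
  shows "scaled_increment f \<longlonglongrightarrow> 0"
proof (rule Lim_null_comparison)
  have L0: "scaled_L n f l = 0" for l
    by (induction l) (use assms in \<open>auto simp: scaled_L_Suc[OF assms(1)] scaled_L_0\<close>)
  have "\<bar>scaled_increment f l\<bar> \<le> (4/5) ^ l * \<bar>scaled_increment f 0\<bar>" for l
  proof (induction l)
    case (Suc l)
    have "\<bar>scaled_increment f (Suc l)\<bar> = 2 / (5 - \<mu> (n + l)) * \<bar>scaled_increment f l\<bar>"
      using eigenvalue_le[of "n + l"] by (simp add: scaled_increment_Suc[OF assms(1)] L0 abs_mult)
    also have "\<dots> \<le> 4/5 * \<bar>scaled_increment f l\<bar>"
      using eigenvalue_le[of "n + l"] by (intro mult_right_mono) (auto simp: field_simps)
    also have "\<dots> \<le> 4/5 * ((4/5) ^ l * \<bar>scaled_increment f 0\<bar>)"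
      using Suc.IH by simp
    finally show ?case by simp
  qed simp
  then show "\<forall>\<^sub>F l in sequentially. norm (scaled_increment f l) \<le> (4/5) ^ l * \<bar>scaled_increment f 0\<bar>"
    by simp
  show "(\<lambda>l. (4/5) ^ l * \<bar>scaled_increment f 0\<bar>) \<longlonglongrightarrow> 0"
    by (intro tendsto_mult_left_zero LIMSEQ_realpow_zero) auto
qed

text \<open>The factors \<open>2 c\<close> tend to \<open>6/5\<close>, hence eventually exceed \<open>11/10\<close>, and the growth is
  geometric.\<close>

lemma scaled_L_at_top:
  assumes "P n f" "L n f > 0"
  shows "filterlim (scaled_L n f) at_top sequentially" and "scaled_L n f l > 0"
proof -
  have pos: "scaled_L n f l > 0" for l
    by (induction l) (use assms slope_factor_pos in \<open>auto simp: scaled_L_Suc[OF assms(1)] scaled_L_0\<close>)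
  then show "scaled_L n f l > 0" .
  have "(\<lambda>l. 2 * slope_factor (n + l)) \<longlonglongrightarrow> 2 * ((3 - 0) / (5 - 0))"
    unfolding slope_factor_def
    using LIMSEQ_ignore_initial_segment[OF eigenvalue_lim, of n]
      LIMSEQ_ignore_initial_segment[OF eigenvalue_lim, of "Suc n"]
    by (intro tendsto_intros) (auto simp: add.commute)
  then have "\<forall>\<^sub>F l in sequentially. 2 * slope_factor (n + l) > 11/10"
    by (rule order_tendstoD) simp
  then obtain l0 where l0: "\<And>l. l \<ge> l0 \<Longrightarrow> 2 * slope_factor (n + l) > 11/10"
    by (auto simp: eventually_sequentially)
  have "scaled_L n f (l0 + l) \<ge> (11/10) ^ l * scaled_L n f l0" for l
  proof (induction l)
    case (Suc l)
    have "(11/10) ^ Suc l * scaled_L n f l0 \<le> 11/10 * scaled_L n f (l0 + l)"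
      using Suc.IH by (simp add: mult_ac)
    also have "\<dots> \<le> 2 * slope_factor (n + (l0 + l)) * scaled_L n f (l0 + l)"
      using l0[of "l0 + l"] pos[of "l0 + l"] by (intro mult_right_mono) auto
    finally show ?case by (simp add: scaled_L_Suc[OF assms(1)])
  qed simp
  then have grow: "\<forall>\<^sub>F l in sequentially. (11/10) ^ l * scaled_L n f l0 \<le> scaled_L n f (l + l0)"
    by (simp add: add.commute)
  have "filterlim (\<lambda>l. (11/10) ^ l * scaled_L n f l0) at_top sequentially"
    using pos[of l0]
    by (subst mult.commute, intro filterlim_tendsto_pos_mult_at_top[OF tendsto_const]
        filterlim_at_infinity_imp_filterlim_at_top filterlim_realpow_sequentially_gt1) auto
  then have "filterlim (\<lambda>l. scaled_L n f (l + l0)) at_top sequentially"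
    using grow by (rule filterlim_at_top_mono)
  then show "filterlim (scaled_L n f) at_top sequentially"
    unfolding filterlim_at_top
    by (simp add: eventually_sequentially_seg[of "\<lambda>l. _ \<le> scaled_L n f l"])
qed

text \<open>The rescaled increments \<open>X\<close> satisfy \<open>X' = a (Y + X)\<close>, where \<open>Y\<close> is the rescaled slope
  and \<open>0 \<le> a \<le> 1\<close>.  Since \<open>Y > 0\<close>, the sequence \<open>X\<close> is bounded below; since \<open>a\<close> stays away
  from \<open>0\<close> and \<open>Y\<close> tends to infinity, so does \<open>X\<close>.\<close>

theorem scaled_increment_at_top:
  assumes "P n f" "L n f > 0"
  shows "filterlim (scaled_increment f) at_top sequentially"
proof -
  define B where "B = \<bar>scaled_increment f 0\<bar>"
  define a where "a l = 2 / (5 - \<mu> (n + l))" for l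
  have a: "0 \<le> a l" "a l \<le> 1" for l
    using eigenvalue_le[of "n + l"] by (auto simp: a_def field_simps)
  note Y = scaled_L_at_top[OF assms]
  have X: "scaled_increment f (Suc l) = a l * (scaled_L n f l + scaled_increment f l)" for l
    by (simp add: a_def scaled_increment_Suc[OF assms(1)])
  have low: "- B \<le> scaled_increment f l" for l
  proof (induction l)
    case 0
    show ?case by (simp add: B_def)
  next
    case (Suc l)
    have "- B \<le> a l * - B"
      using a[of l] by (simp add: B_def mult_left_le_one_le)
    also have "\<dots> \<le> scaled_increment f (Suc l)"
      unfolding X using a[of l] Suc Y(2)[of l] by (intro mult_left_mono) auto
    finally show ?case .
  qed
  have "(\<lambda>l. \<mu> (n + l)) \<longlonglongrightarrow> 0"
    using LIMSEQ_ignore_initial_segment[OF eigenvalue_lim, of n] by (simp add: add.commute)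
  then have "\<forall>\<^sub>F l in sequentially. \<mu> (n + l) > -1"
    by (rule order_tendstoD) simp
  then have "\<forall>\<^sub>F l in sequentially. - B + 1/3 * scaled_L n f l \<le> scaled_increment f (Suc l)"
  proof eventually_elim
    case (elim l)
    have "1/3 * scaled_L n f l \<le> a l * scaled_L n f l"
      using elim eigenvalue_le[of "n + l"] Y(2)[of l]
      by (intro mult_right_mono) (auto simp: a_def field_simps)
    moreover have "a l * - B \<le> a l * scaled_increment f l"
      using a[of l] low[of l] by (intro mult_left_mono)
    moreover have "- B \<le> a l * - B"
      using a[of l] by (simp add: B_def mult_left_le_one_le)
    ultimately show ?case unfolding X distrib_left by linarith
  qed
  moreover have "filterlim (\<lambda>l. - B + 1/3 * scaled_L n f l) at_top sequentially"
    by (intro filterlim_tendsto_add_at_top[OF tendsto_const]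
        filterlim_tendsto_pos_mult_at_top[OF tendsto_const] Y(1)) auto
  ultimately have "filterlim (\<lambda>l. scaled_increment f (Suc l)) at_top sequentially"
    by (rule filterlim_at_top_mono[rotated])
  then show ?thesis by (simp add: filterlim_sequentially_Suc)
qed

corollary abs_scaled_increment_at_top:
  assumes "P n f" "L n f \<noteq> 0"
  shows "filterlim (\<lambda>l. \<bar>scaled_increment f l\<bar>) at_top sequentially"
proof -
  consider "L n f > 0" | "L n (\<lambda>x. - f x) > 0" using assms(2) by (force simp: L_negate)
  then show ?thesis
  proof cases
    case 1
    show ?thesis
      by (rule filterlim_at_top_mono[OF scaled_increment_at_top[OF assms(1) 1]])
        (intro always_eventually allI abs_ge_self)
  next
    case 2
    have "- scaled_increment f l = scaled_increment (\<lambda>x. - f x) l" for l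
      by (simp add: scaled_increment_def algebra_simps)
    then have "scaled_increment (\<lambda>x. - f x) l \<le> \<bar>scaled_increment f l\<bar>" for l
      by (metis abs_ge_minus_self)
    then show ?thesis
      by (intro filterlim_at_top_mono[OF scaled_increment_at_top[OF negate[OF assms(1)] 2]]) simp
  qed
qed

corollary eventually_above_left_endpoint:
  assumes "P n f" "L n f > 0"
  obtains x where "0 < x" "x \<le> 1" "f 0 < f x"
proof -
  obtain l where "scaled_increment f l > 0"
    using scaled_increment_at_top[OF assms]
    by (auto simp: filterlim_at_top_dense eventually_sequentially)
  then show thesis
    by (intro that[of "1 / 2 ^ l"]) (auto simp: scaled_increment_def zero_less_mult_iff)
qed

text \<open>Bisection.  The outer slopes keep their signs on the two halves, and the common slope at the
  midpoint has the sign of \<open>f 1 - f 0\<close>.  A rising function is thus increasing on the left half and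
  of mixed type on the right half; a falling one is of mixed type on the left half and decreasing
  on the right half.\<close>

lemma approximately_unimodal:
  assumes "P n f" "L n f > 0" "R n f < 0"
  shows "\<exists>a b. 0 \<le> a \<and> a \<le> b \<and> b \<le> 1 \<and> b - a \<le> 1 / 2 ^ l
    \<and> strict_mono_on {0..a} f \<and> strict_antimono_on {b..1} f"
  using assms
proof (induction l arbitrary: n f)
  case 0
  show ?case by (intro exI[of _ 0] exI[of _ 1]) (auto simp: monotone_on_def)
next
  case (Suc l)
  note P = Suc.prems(1)
  let ?g = "\<lambda>x. f (x / 2)" and ?h = "\<lambda>x. f ((x + 1) / 2)"
  have slopes: "L (Suc n) ?g > 0" "R (Suc n) ?h < 0"
    using Suc.prems slope_factor_pos[of n] by (auto simp: L_left_half R_right_half mult_less_0_iff)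
  have left_inc: "strict_mono_on {0..1/2} f" if "f 0 \<le> f 1"
    using strictly_increasing[OF left_half[OF P]] slopes that slope_factor_pos[of n]
      strict_mono_on_affine[of 0 1 f 0] by (simp add: R_left_half[OF P])
  have right_dec: "strict_antimono_on {1/2..1} f" if "f 1 \<le> f 0"
    using strictly_decreasing[OF right_half[OF P]] slopes that slope_factor_pos[of n]
      strict_antimono_on_affine[of 0 1 f 1] by (simp add: L_right_half[OF P] mult_le_0_iff)
  consider "f 0 = f 1" | "f 0 < f 1" | "f 1 < f 0" by linarith
  then show ?case
  proof cases
    case 1
    then show ?thesis using left_inc right_dec by (intro exI[of _ "1/2"]) auto
  next
    case 2
    then have "L (Suc n) ?h > 0" using slope_factor_pos[of n] by (simp add: L_right_half[OF P])
    from Suc.IH[OF right_half[OF P] this slopes(2)] obtain a b where ab: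
      "0 \<le> a" "a \<le> b" "b \<le> 1" "b - a \<le> 1 / 2 ^ l"
      "strict_mono_on {0..a} ?h" "strict_antimono_on {b..1} ?h" by blast
    have "strict_mono_on {0..(a + 1) / 2} f"
      by (rule strict_mono_on_glue[of 0 "1/2"])
        (use left_inc strict_mono_on_affine[OF ab(5)] 2 in simp_all)
    moreover have "strict_antimono_on {(b + 1) / 2..1} f"
      using strict_antimono_on_affine[OF ab(6)] by simp
    ultimately show ?thesis using ab(1-4)
      by (intro exI[of _ "(a + 1) / 2"] exI[of _ "(b + 1) / 2"]) (auto simp: field_simps)
  next
    case 3
    then have "R (Suc n) ?g < 0" using slope_factor_pos[of n] by (simp add: R_left_half[OF P] mult_less_0_iff)
    from Suc.IH[OF left_half[OF P] slopes(1) this] obtain a b where ab: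
      "0 \<le> a" "a \<le> b" "b \<le> 1" "b - a \<le> 1 / 2 ^ l"
      "strict_mono_on {0..a} ?g" "strict_antimono_on {b..1} ?g" by blast
    have "strict_antimono_on {b / 2..1} f"
      by (rule strict_antimono_on_glue[of _ "1/2"])
        (use right_dec strict_antimono_on_affine[of b 1 f 0] ab(6) 3 in simp_all)
    moreover have "strict_mono_on {0..a / 2} f"
      using strict_mono_on_affine[of 0 a f 0] ab(5) by simp
    ultimately show ?thesis using ab(1-4)
      by (intro exI[of _ "a / 2"] exI[of _ "b / 2"]) (auto simp: field_simps)
  qed
qed

text \<open>The turning point is interior because, next to either endpoint, the function takes values
  above the endpoint value: the difference quotients there tend to infinity.\<close>

theorem unimodal:
  assumes "P n f" "L n f > 0" "R n f < 0"
  obtains c where "0 < c" "c < 1" "strict_mono_on {0..c} f" "strict_antimono_on {c..1} f"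
proof -
  obtain c where c: "c \<in> {0..1}" "strict_mono_on {0..c} f" "strict_antimono_on {c..1} f"
    using unimodal_if_approximately_unimodal[OF continuous[OF assms(1)]]
      approximately_unimodal[OF assms] by blast
  obtain x where x: "0 < x" "x \<le> 1" "f 0 < f x"
    using eventually_above_left_endpoint[OF assms(1,2)] .
  have "c \<noteq> 0"
  proof
    assume "c = 0"
    then have "f x < f 0" using c(3) x by (simp add: monotone_on_def)
    then show False using x by simp
  qed
  moreover obtain y where y: "0 < y" "y \<le> 1" "f 1 < f (1 - y)"
    using eventually_above_left_endpoint[OF reflect[OF assms(1)]] assms(3)
    by (auto simp: L_reflect)
  have "c \<noteq> 1"
  proof
    assume "c = 1"
    then have "f (1 - y) < f 1" using c(2) y by (simp add: monotone_on_def)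
    then show False using y by simp
  qed
  ultimately show thesis using c that[of c] by auto
qed

end

section \<open>Words and cells\<close>

lemma word_map_Nil [simp]: "word_map p [] = id"
  and word_map_Cons [simp]: "word_map p (i # w) = contraction p i \<circ> word_map p w"
  by (simp_all add: word_map_def)

lemma word_map_append: "word_map p (v @ w) = word_map p v \<circ> word_map p w"
  by (induction v) (simp_all add: comp_assoc)

lemma contraction_eq_midpoint: "contraction p i x = midpoint (p i) x"
  by (simp add: contraction_def midpoint_def vec_eq_iff field_simps)

lemma contraction_affine:
  "contraction p i ((1 - t) *\<^sub>R x + t *\<^sub>R y) = (1 - t) *\<^sub>R contraction p i x + t *\<^sub>R contraction p i y"
  by (simp add: contraction_def vec_eq_iff field_simps)

lemma contraction_fixed: "contraction p i (p i) = p i"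
  by (simp add: contraction_def)

lemma inj_word_map: "inj (word_map p w)"
proof (induction w)
  case (Cons i w)
  have "inj (contraction p i)" by (simp add: inj_def contraction_def)
  then show ?case unfolding word_map_Cons using Cons by (rule inj_compose)
qed simp

lemma word_map_affine:
  "word_map p w ((1 - t) *\<^sub>R x + t *\<^sub>R y) = (1 - t) *\<^sub>R word_map p w x + t *\<^sub>R word_map p w y"
  by (induction w) (simp_all add: contraction_affine)

lemma word_map_midpoint: "word_map p w (midpoint x y) = midpoint (word_map p w x) (word_map p w y)"
  using word_map_affine[of p w "1/2" x y] by (simp add: midpoint_def scaleR_add_right)

lemma word_map_linepath: "word_map p w (linepath x y t) = linepath (word_map p w x) (word_map p w y) t"
  by (simp add: linepath_def word_map_affine)

lemma lessThan_3: "{..<3::nat} = {0, 1, 2}"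
  by (auto simp: numeral_3_eq_3 less_Suc_eq)

lemma distinct_letters:
  assumes "{i, j, l} = {..<3::nat}"
  shows "i \<noteq> j \<and> i \<noteq> l \<and> j \<noteq> l"
proof -
  have "card {i, j, l} = 3" by (simp only: assms card_lessThan)
  then show ?thesis by (auto simp: card_insert_if split: if_splits)
qed

declare V.simps [simp del]

text \<open>The vertex sets are defined by adding letters at the front; this form, by cells, is
  the one that adjacency refers to.\<close>

lemma V_eq: "V q m = (\<Union>w\<in>{w. length w = m \<and> set w \<subseteq> {..<3}}. word_map q w ` V q 0)"
proof (induction m)
  case (Suc m)
  show ?case (is "?A = ?B")
  proof
    show "?A \<subseteq> ?B"
    proof
      fix x assume "x \<in> ?A"
      then obtain i w y where "i < 3" "length w = m" "set w \<subseteq> {..<3}" "y \<in> V q 0"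
        "x = contraction q i (word_map q w y)" unfolding V.simps(2) Suc by auto
      then show "x \<in> ?B" by (intro UN_I[of "i # w"] image_eqI[of _ _ y]) auto
    qed
    show "?B \<subseteq> ?A"
    proof
      fix x assume "x \<in> ?B"
      then obtain w y where w: "length w = Suc m" "set w \<subseteq> {..<3}" "y \<in> V q 0"
        "x = word_map q w y" by auto
      then obtain i v where "w = i # v" by (cases w) auto
      then have "i < 3" "x = contraction q i (word_map q v y)" "length v = m" "set v \<subseteq> {..<3}"
        using w by auto
      then show "x \<in> ?A" unfolding V.simps(2) Suc using w(3) by blast
    qed
  qed
qed simp

lemma V_0_eq: "V q 0 = q ` {..<3}"
  by (simp add: V.simps lessThan_3)

section \<open>Barycentric coordinates\<close>

text \<open>With \<open>a\<close>, \<open>b\<close> the edge vectors at \<open>q 0\<close> and \<open>d = \<bar>a\<bar>\<^sup>2\<close>, the triangle being equilateral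
  gives \<open>a \<bullet> b = d / 2\<close>; the gradients below point along the medians.  The values of
  these affine functions tell the cells apart, in place of arguments about plane figures.\<close>

lemma barycentric_coordinates:
  assumes "equilateral q"
  obtains h :: "nat \<Rightarrow> plane \<Rightarrow> real" where
    "\<And>i j. i < 3 \<Longrightarrow> j < 3 \<Longrightarrow> h i (q j) = (if i = j then 1 else 0)"
    "\<And>i j x. h i (contraction q j x) = (h i x + h i (q j)) / 2"
proof -
  define a b where "a = q 1 - q 0" and "b = q 2 - q 0"
  define d where "d = a \<bullet> a"
  have d0: "d > 0" using assms by (auto simp: d_def a_def equilateral_def)
  have "norm a = norm (b - a)" "norm (b - a) = norm b"
    using assms unfolding equilateral_def a_def b_def dist_norm
    by (simp_all add: norm_minus_commute)
  then have "a \<bullet> a = (b - a) \<bullet> (b - a)" "b \<bullet> b = (b - a) \<bullet> (b - a)"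
    by (metis dot_square_norm)+
  then have inn: "a \<bullet> a = d" "b \<bullet> b = d" "a \<bullet> b = d / 2" "b \<bullet> a = d / 2"
    unfolding d_def inner_diff_left inner_diff_right using inner_commute[of a b] by linarith+
  define g where "g = (\<lambda>i::nat. if i = 0 then - a - b else if i = 1 then 2 *\<^sub>R a - b else 2 *\<^sub>R b - a)"
  \<comment> \<open>The normalisation: \<open>a \<bullet> (2 a - b) = 3 d / 2\<close>.\<close>
  define c where "c = 2 / (3 * d)"
  define h where "h = (\<lambda>i x. (if i = 0 then 1 else 0) + c * ((x - q 0) \<bullet> g i))"
  show thesis
  proof
    fix i j :: nat assume ij: "i < 3" "j < 3"
    then have cases: "i = 0 \<or> i = 1 \<or> i = 2" "j = 0 \<or> j = 1 \<or> j = 2" by auto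
    have "q j - q 0 = (if j = 0 then 0 else if j = 1 then a else b)"
      using cases(2) by (auto simp: a_def b_def)
    then have "h i (q j) = (if i = 0 then 1 else 0)
      + c * ((if j = 0 then 0 else if j = 1 then a else b) \<bullet> g i)"
      by (simp only: h_def)
    then show "h i (q j) = (if i = j then 1 else 0)"
      using cases d0 by (elim disjE) (simp_all add: g_def c_def inner_diff inn)
  next
    fix i j x
    show "h i (contraction q j x) = (h i x + h i (q j)) / 2"
    proof -
      have "contraction q j x - q 0 = (1/2) *\<^sub>R ((x - q 0) + (q j - q 0))"
        by (simp add: contraction_def vec_eq_iff field_simps)
      then show ?thesis
        unfolding h_def by (simp only: inner_scaleR_left inner_add_left) (simp add: field_simps)
    qed
  qed
qed

context
  fixes q :: "nat \<Rightarrow> plane" and h :: "nat \<Rightarrow> plane \<Rightarrow> real"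
  assumes hq: "\<And>i j. i < 3 \<Longrightarrow> j < 3 \<Longrightarrow> h i (q j) = (if i = j then 1 else 0)"
    and hc: "\<And>i j x. h i (contraction q j x) = (h i x + h i (q j)) / 2"
begin

lemma coordinate_nonneg:
  assumes "i < 3" "set w \<subseteq> {..<3}" "j < 3"
  shows "h i (word_map q w (q j)) \<ge> 0"
  using assms(2) by (induction w) (use assms in \<open>auto simp: hq hc\<close>)

lemma coordinate_ge_half:
  assumes "i < 3" "set w \<subseteq> {..<3}" "j < 3"
  shows "h i (word_map q (i # w) (q j)) \<ge> 1/2"
  using coordinate_nonneg[OF assms] assms by (simp add: hq hc)

lemma coordinate_less_one:
  assumes "i < 3" "set w \<subseteq> {..<3}" "h i y < 1"
  shows "h i (word_map q w y) < 1"
  using assms(2) by (induction w) (use assms in \<open>auto simp: hq hc\<close>)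

lemma coordinate_edge_midpoint:
  assumes "a < 3" "i < 3" "j < 3" 
  shows "h a (contraction q i (q j)) = ((if a = i then 1 else 0) + (if a = j then 1 else 0)) / 2"
  using assms by (simp add: hq hc)

lemma coordinate_edge_midpoint_less_one:
  assumes "a < 3" "i < 3" "j < 3" "i \<noteq> j"
  shows "h a (contraction q i (q j)) < 1"
  using assms by (simp add: coordinate_edge_midpoint)

text \<open>Induction along the word.  If the first letters \<open>a\<close> of \<open>v\<close> and \<open>b\<close> of the word differ, the
  \<open>a\<close>-th coordinate of the point would be at least \<open>1/2\<close>, as the point lies in cell \<open>a\<close>, and less
  than \<open>1/2\<close>, as \<open>contraction q b\<close> halves that coordinate and an edge midpoint, being no vertex
  of the triangle, starts with less than \<open>1\<close>.  At the end
  of the word, the midpoint of \<open>q i\<close> and \<open>q j\<close> has coordinate \<open>0\<close> at the third vertex, so it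
  misses the third cell.\<close>

lemma cells_at_midpoint:
  assumes "set w \<subseteq> {..<3}" "i < 3" "j < 3" "i \<noteq> j"
    and "set v \<subseteq> {..<3}" "length v = Suc (length w)" "l < 3"
    and "word_map q v (q l) = word_map q w (contraction q i (q j))"
  shows "v = w @ [i] \<or> v = w @ [j]"
  using assms
proof (induction w arbitrary: v)
  case Nil
  then obtain a where v: "v = [a]" by (cases v) auto
  have "h a (word_map q v (q l)) \<ge> 1/2"
    using Nil v coordinate_ge_half[of a "[]" l] by simp
  then have "a = i \<or> a = j"
    using Nil v coordinate_edge_midpoint[of a i j] by (auto split: if_splits)
  then show ?case using v by auto
next
  case (Cons b w)
  then obtain a v' where v: "v = a # v'" by (cases v) auto
  let ?m = "contraction q i (q j)"
  have a: "a < 3" and b: "b < 3" using Cons.prems v by auto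
  have "a = b"
  proof (rule ccontr)
    assume "a \<noteq> b"
    have "h a ?m < 1" using a Cons.prems by (intro coordinate_edge_midpoint_less_one)
    then have "h a (word_map q w ?m) < 1"
      using Cons.prems a by (intro coordinate_less_one) auto
    then have "h a (word_map q (b # w) ?m) < 1/2"
      using \<open>a \<noteq> b\<close> a b by (simp add: hc hq)
    moreover have "h a (word_map q v (q l)) \<ge> 1/2"
      unfolding v using Cons.prems v by (intro coordinate_ge_half) auto
    ultimately show False using Cons.prems(8) by simp
  qed
  then have "word_map q v' (q l) = word_map q w ?m"
    using Cons.prems(8) v by (auto simp: contraction_def)
  then have "v' = w @ [i] \<or> v' = w @ [j]"
    using Cons.prems v by (intro Cons.IH) auto
  then show ?case using v \<open>a = b\<close> by auto
qed

lemma midpoint_notin_V0: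
  assumes "set w \<subseteq> {..<3}" "i < 3" "j < 3" "i \<noteq> j"
  shows "word_map q w (contraction q i (q j)) \<notin> V q 0"
proof
  assume "word_map q w (contraction q i (q j)) \<in> V q 0"
  then obtain a where a: "a < 3" "word_map q w (contraction q i (q j)) = q a"
    unfolding V_0_eq by auto
  have "h a (word_map q w (contraction q i (q j))) < 1"
    using assms a by (intro coordinate_less_one coordinate_edge_midpoint_less_one) auto
  then show False using a by (simp add: hq)
qed

text \<open>The midpoint of an edge lies in the two subcells at the ends of that edge and in no other, so
  its neighbours are the remaining vertices of these two.  That the four points are distinct is
  read off from two coordinates; the graph Laplacian, a sum over a set, needs it.\<close>

lemma midpoint_neighbours:
  assumes w: "set w \<subseteq> {..<3}" "length w = k" and ijl: "{i, j, l} = {..<3}"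
  shows "{y. adj q (Suc k) (word_map q w (contraction q i (q j))) y}
    = word_map q w ` {q i, q j, contraction q i (q l), contraction q j (q l)}"
    (is "{y. adj q _ ?m y} = ?N")
    and "inj_on (word_map q w) {q i, q j, contraction q i (q l), contraction q j (q l)}"
    and "distinct [q i, q j, contraction q i (q l), contraction q j (q l)]"
proof -
  have lt: "i < 3" "j < 3" "l < 3" using ijl by auto
  have ne: "i \<noteq> j" "i \<noteq> l" "j \<noteq> l" using distinct_letters[OF ijl] by auto
  have V0: "V q 0 = {q i, q j, q l}" unfolding V_0_eq ijl[symmetric] by simp
  have sym: "contraction q j (q i) = contraction q i (q j)"
    by (simp add: contraction_eq_midpoint midpoint_sym)
  have coords: "h i (contraction q i (q j)) = 1/2" "h j (contraction q i (q j)) = 1/2"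
     "h l (contraction q i (q j)) = 0" "h l (contraction q i (q l)) = 1/2"
     "h l (contraction q j (q l)) = 1/2" "h i (contraction q i (q l)) = 1/2"
     "h i (contraction q j (q l)) = 0" "h i (q i) = 1" "h i (q j) = 0" "h l (q i) = 0" "h l (q j) = 0"
    using lt ne by (simp_all add: hq hc)
  show inj: "inj_on (word_map q w) {q i, q j, contraction q i (q l), contraction q j (q l)}"
    using inj_word_map inj_on_subset by blast
  have "distinct (map (\<lambda>x. (h i x, h l x))
    [q i, q j, contraction q i (q l), contraction q j (q l), contraction q i (q j)])"
    by (simp add: coords)
  then have dist: "distinct [q i, q j, contraction q i (q l), contraction q j (q l), contraction q i (q j)]"
    unfolding distinct_map by blast
  then show "distinct [q i, q j, contraction q i (q l), contraction q j (q l)]" by simp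
  have cell: "word_map q (w @ [a]) ` V q 0 = word_map q w ` contraction q a ` {q i, q j, q l}" for a
    unfolding V0 by (simp add: word_map_append image_comp)
  have sub: "adj q (Suc k) ?m y \<longleftrightarrow> y \<noteq> ?m \<and> (y \<in> word_map q (w @ [i]) ` V q 0 \<or> y \<in> word_map q (w @ [j]) ` V q 0)" for y
  proof
    assume "adj q (Suc k) ?m y"
    then obtain v where v: "y \<noteq> ?m" "length v = Suc k" "set v \<subseteq> {..<3}"
      "?m \<in> word_map q v ` V q 0" "y \<in> word_map q v ` V q 0" by (auto simp: adj_def)
    then obtain n where "n < 3" "word_map q v (q n) = ?m" unfolding V_0_eq by auto
    then have "v = w @ [i] \<or> v = w @ [j]"
      using v w lt ne by (intro cells_at_midpoint) auto
    then show "y \<noteq> ?m \<and> (y \<in> word_map q (w @ [i]) ` V q 0 \<or> y \<in> word_map q (w @ [j]) ` V q 0)"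
      using v by auto
  next
    assume y: "y \<noteq> ?m \<and> (y \<in> word_map q (w @ [i]) ` V q 0 \<or> y \<in> word_map q (w @ [j]) ` V q 0)"
    have "?m \<in> word_map q (w @ [i]) ` V q 0" "?m \<in> word_map q (w @ [j]) ` V q 0"
      unfolding cell using sym by auto
    moreover have "length (w @ [a]) = Suc k" "a < 3 \<Longrightarrow> set (w @ [a]) \<subseteq> {..<3}" for a
      using w by auto
    ultimately show "adj q (Suc k) ?m y"
      unfolding adj_def using y lt by (metis empty_subsetI insert_subset)
  qed
  have "?m \<notin> ?N"
  proof
    assume "?m \<in> ?N"
    then have "contraction q i (q j) \<in> {q i, q j, contraction q i (q l), contraction q j (q l)}"
      using inj_image_mem_iff[OF inj_word_map] by blast
    then show False using dist by auto
  qed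
  then show "{y. adj q (Suc k) ?m y} = ?N"
    unfolding sub cell using sym by (auto simp: contraction_fixed)
qed

end

lemma midpoint_equation:
  assumes "equilateral q" and w: "set w \<subseteq> {..<3}" "length w = k" and ijl: "{i, j, l} = {..<3}"
    and u: "graph_eigenfunction q bc (Suc k) u \<mu>"
  shows "(4 - \<mu>) * u (midpoint (word_map q w (q i)) (word_map q w (q j)))
    = u (word_map q w (q i)) + u (word_map q w (q j))
      + u (midpoint (word_map q w (q i)) (word_map q w (q l)))
      + u (midpoint (word_map q w (q j)) (word_map q w (q l)))"
proof -
  obtain h :: "nat \<Rightarrow> plane \<Rightarrow> real" where h:
    "\<And>i j. i < 3 \<Longrightarrow> j < 3 \<Longrightarrow> h i (q j) = (if i = j then 1 else 0)"
    "\<And>i j x. h i (contraction q j x) = (h i x + h i (q j)) / 2"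
    using barycentric_coordinates[OF assms(1)] by blast
  let ?x = "word_map q w (contraction q i (q j))"
  have lt: "i < 3" "j < 3" "l < 3" using ijl by auto
  have ne: "i \<noteq> j" using distinct_letters[OF ijl] by simp
  have "?x = word_map q (w @ [i]) (q j)" by (simp add: word_map_append)
  then have "?x \<in> word_map q (w @ [i]) ` V q 0" using lt by (simp add: V_0_eq)
  then have "?x \<in> V q (Suc k)"
    using w lt by (subst V_eq, intro UN_I[of "w @ [i]"]) auto
  moreover have "?x \<notin> V q 0" by (rule midpoint_notin_V0[of h, OF h w(1) lt(1,2) ne])
  ultimately have eigen: "- graph_laplacian q (Suc k) u ?x = \<mu> * u ?x"
    using u by (simp add: graph_eigenfunction_def)
  note nb = midpoint_neighbours[of h, OF h w ijl]
  from nb(1) have "graph_laplacian q (Suc k) u ?x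
    = (\<Sum>y\<in>word_map q w ` {q i, q j, contraction q i (q l), contraction q j (q l)}. u y - u ?x)"
    unfolding graph_laplacian_def by simp
  also have "\<dots> = (\<Sum>y\<in>{q i, q j, contraction q i (q l), contraction q j (q l)}. u (word_map q w y) - u ?x)"
    by (simp only: sum.reindex[OF nb(2)] comp_def)
  finally have "graph_laplacian q (Suc k) u ?x = u (word_map q w (q i)) + u (word_map q w (q j))
      + u (word_map q w (contraction q i (q l))) + u (word_map q w (contraction q j (q l))) - 4 * u ?x"
    using nb(3) by simp
  then show ?thesis
    using eigen by (simp add: contraction_eq_midpoint word_map_midpoint algebra_simps)
qed

section \<open>The gasket\<close>

lemma contraction_dist: "dist (contraction q i x) (contraction q i y) = dist x y / 2"
proof -
  have "contraction q i x - contraction q i y = (1/2) *\<^sub>R (x - y)"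
    by (simp add: contraction_def vec_eq_iff field_simps)
  then show ?thesis by (simp add: dist_norm)
qed

text \<open>On \<open>K\<close> the distance to \<open>K'\<close> attains its maximum at some point \<open>contraction q i y\<close>, where it
  is at most half the distance of \<open>y\<close> to \<open>K'\<close>.  Hence the maximum is at most half of
  itself.\<close>

lemma attractor_subset:
  assumes K: "compact K" "K = (\<Union>i<3. contraction q i ` K)"
    and K': "compact K'" "K' \<noteq> {}" "K' = (\<Union>i<(3::nat). contraction q i ` K')"
  shows "K \<subseteq> K'"
proof (cases "K = {}")
  case False
  have "continuous_on K (\<lambda>x. infdist x K')" by (intro continuous_intros)
  then obtain x where x: "x \<in> K" "\<And>y. y \<in> K \<Longrightarrow> infdist y K' \<le> infdist x K'"
    using continuous_attains_sup[OF K(1) False] by blast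
  obtain i y where i: "i < 3" and y: "y \<in> K" "x = contraction q i y"
    using x(1) by (subst (asm) K(2)) blast
  obtain z where z: "z \<in> K'" "infdist y K' = dist y z"
    using infdist_attains_inf[OF compact_imp_closed[OF K'(1)] K'(2)] by blast
  have "contraction q i z \<in> K'" using z i by (subst K'(3)) auto
  then have "infdist x K' \<le> dist x (contraction q i z)" by (rule infdist_le)
  also have "\<dots> = infdist y K' / 2" by (simp add: y z contraction_dist)
  also have "\<dots> \<le> infdist x K' / 2" using x(2)[OF y(1)] by simp
  finally have "infdist x K' = 0" using infdist_nonneg[of x K'] by simp
  then have "infdist y K' = 0" if "y \<in> K" for y
    using x(2)[OF that] infdist_nonneg[of y K'] by simp
  then show ?thesis
    using in_closed_iff_infdist_zero[OF compact_imp_closed[OF K'(1)] K'(2)] by blast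
qed simp

lemma closure_contraction_image: "closure (contraction q i ` S) = contraction q i ` closure S"
proof -
  have *: "contraction q i ` A = (\<lambda>x. (1/2) *\<^sub>R q i + x) ` (*\<^sub>R) (1/2) ` A" for A
    by (simp add: image_comp contraction_eq_midpoint midpoint_def scaleR_add_right comp_def)
  show ?thesis unfolding * closure_translation closure_scaleR ..
qed

text \<open>The closure of the union of all vertex sets is invariant because that union is, each
  contraction commuting with closure.\<close>

lemma attractor_exists:
  "\<exists>K. compact K \<and> K \<noteq> {} \<and> K = (\<Union>i<(3::nat). contraction q i ` K)"
proof -
  let ?W = "\<Union>m. V q m"
  define r where "r = Max (norm ` q ` {..<3})"
  have r: "norm (q i) \<le> r" if "i < 3" for i
    unfolding r_def using that by (intro Max_ge) auto
  have "norm x \<le> r" if "x \<in> V q m" for x m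
    using that
  proof (induction m arbitrary: x)
    case 0
    then show ?case unfolding V_0_eq using r by auto
  next
    case (Suc m)
    then obtain i y where "i < 3" "y \<in> V q m" "x = midpoint (q i) y"
      by (auto simp: contraction_eq_midpoint V.simps)
    then show ?case using r[of i] Suc.IH[of y] norm_triangle_ineq[of "q i" y]
      by (simp add: midpoint_def)
  qed
  then have "bounded ?W" unfolding bounded_iff by blast
  then have 1: "compact (closure ?W)" by (simp add: compact_closure)
  have "?W = (\<Union>i<3. contraction q i ` ?W)"
  proof
    have "V q m \<subseteq> (\<Union>i<3. contraction q i ` ?W)" for m
    proof (cases m)
      case 0
      have "V q 0 \<subseteq> (\<Union>i<3. contraction q i ` V q 0)"
        unfolding V_0_eq using contraction_fixed[of q] by (smt (verit) UN_iff imageE image_eqI subsetI)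
      then show ?thesis unfolding 0 by blast
    qed (auto simp: V.simps)
    then show "?W \<subseteq> (\<Union>i<3. contraction q i ` ?W)" by blast
    have "contraction q i ` V q m \<subseteq> V q (Suc m)" if "i < 3" for i m
      using that by (auto simp: V.simps)
    then show "(\<Union>i<3. contraction q i ` ?W) \<subseteq> ?W" by blast
  qed
  then have "closure ?W = closure (\<Union>i<3. contraction q i ` ?W)" by (rule arg_cong)
  also have "\<dots> = (\<Union>i<3. contraction q i ` closure ?W)"
    unfolding lessThan_3 by (simp add: closure_contraction_image)
  finally have 2: "closure ?W = (\<Union>i<3. contraction q i ` closure ?W)" .
  have "q 0 \<in> V q 0" by (simp add: V.simps)
  then have 3: "closure ?W \<noteq> {}" using closure_subset[of ?W] by blast
  show ?thesis using 1 2 3 by blast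
qed

lemma SG_attractor: "compact (SG q)" "SG q \<noteq> {}" "SG q = (\<Union>i<3. contraction q i ` SG q)"
proof -
  have "\<exists>!K. compact K \<and> K \<noteq> {} \<and> K = (\<Union>i<(3::nat). contraction q i ` K)"
    using attractor_exists[of q] attractor_subset[of _ q] by (metis subset_antisym)
  from theI'[OF this] show "compact (SG q)" "SG q \<noteq> {}" "SG q = (\<Union>i<3. contraction q i ` SG q)"
    unfolding SG_def by blast+
qed

lemma contraction_in_SG: "i < 3 \<Longrightarrow> x \<in> SG q \<Longrightarrow> contraction q i x \<in> SG q"
  using equalityD2[OF SG_attractor(3)[of q]] by blast

lemma word_map_in_SG: "set w \<subseteq> {..<3} \<Longrightarrow> x \<in> SG q \<Longrightarrow> word_map q w x \<in> SG q"
  by (induction w) (auto intro: contraction_in_SG)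

text \<open>A point of the edge lies in images of the edge under words of any length.
  Replacing the edge by a point of the gasket moves it by at most \<open>2^-n\<close> times a constant, so its distance to the closed
  gasket is \<open>0\<close>.\<close>

lemma base_edge_subset_SG:
  assumes "i < 3" "j < 3"
  shows "closed_segment (q i) (q j) \<subseteq> SG q"
proof
  fix x assume x: "x \<in> closed_segment (q i) (q j)"
  have ex: "\<exists>w y. length w = n \<and> set w \<subseteq> {..<3} \<and> y \<in> closed_segment (q i) (q j) \<and> x = word_map q w y" for n
    using x
  proof (induction n arbitrary: x)
    case (Suc n)
    obtain t where t: "0 \<le> t" "t \<le> 1" "x = (1 - t) *\<^sub>R q i + t *\<^sub>R q j"
      using Suc.prems by (auto simp: closed_segment_def)
    obtain a y where a: "a < 3" "y \<in> closed_segment (q i) (q j)" "x = contraction q a y"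
    proof (cases "t \<le> 1/2")
      case True
      show thesis
      proof (rule that[of i])
        show "(1 - 2 * t) *\<^sub>R q i + (2 * t) *\<^sub>R q j \<in> closed_segment (q i) (q j)"
          using t True by (auto simp: closed_segment_def)
      qed (use assms in \<open>simp_all add: contraction_def t vec_eq_iff field_simps\<close>)
    next
      case False
      show thesis
      proof (rule that[of j])
        show "(1 - (2 * t - 1)) *\<^sub>R q i + (2 * t - 1) *\<^sub>R q j \<in> closed_segment (q i) (q j)"
          using t False by (auto simp: closed_segment_def intro!: exI[of _ "2 * t - 1"])
      qed (use assms in \<open>simp_all add: contraction_def t vec_eq_iff field_simps\<close>)
    qed
    obtain w z where "length w = n" "set w \<subseteq> {..<3}" "z \<in> closed_segment (q i) (q j)" "y = word_map q w z"
      using Suc.IH[OF a(2)] by blast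
    then show ?case using a by (intro exI[of _ "a # w"] exI[of _ z]) auto
  qed (auto intro!: exI[of _ "[]"])
  obtain z where z: "z \<in> SG q" using SG_attractor(2) by blast
  obtain B where B: "\<And>y. y \<in> closed_segment (q i) (q j) \<Longrightarrow> dist y z \<le> B"
    using bounded_closed_segment[of "q i" "q j"] by (metis bounded_any_center dist_commute)
  have "infdist x (SG q) \<le> (1/2) ^ n * B" for n
  proof -
    obtain w y where w: "length w = n" "set w \<subseteq> {..<3}" "y \<in> closed_segment (q i) (q j)" "x = word_map q w y"
      using ex by blast
    have "dist (word_map q w y) (word_map q w z) = (1/2) ^ length w * dist y z"
      by (induction w) (simp_all add: contraction_dist)
    moreover have "infdist x (SG q) \<le> dist x (word_map q w z)"
      by (rule infdist_le[OF word_map_in_SG[OF w(2) z]])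
    ultimately show ?thesis using B[OF w(3)] w
      by (metis (no_types, lifting) mult_left_mono order_trans zero_le_power zero_le_divide_1_iff zero_le_numeral)
  qed
  moreover have "(\<lambda>n. (1/2) ^ n * B) \<longlonglongrightarrow> 0"
    by (intro tendsto_mult_left_zero LIMSEQ_realpow_zero) auto
  ultimately have "infdist x (SG q) \<le> 0"
    by (intro LIMSEQ_le_const) auto
  then show "x \<in> SG q"
    using in_closed_iff_infdist_zero[OF compact_imp_closed[OF SG_attractor(1)] SG_attractor(2)]
      infdist_nonneg[of x "SG q"] by simp
qed

section \<open>Edges\<close>

lemma adjE:
  assumes "adj q m a b"
  obtains w i j l where "set w \<subseteq> {..<3}" "length w = m" "{i, j, l} = {..<3}" "i \<noteq> j"
    "a = word_map q w (q i)" "b = word_map q w (q j)"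
proof -
  obtain w i j where w: "length w = m" "set w \<subseteq> {..<3}" "i < 3" "j < 3" "a \<noteq> b"
    "a = word_map q w (q i)" "b = word_map q w (q j)"
    using assms unfolding adj_def V_0_eq by auto
  moreover have "{i, j, 3 - i - j} = {..<3::nat}"
  proof -
    have "i = 0 \<or> i = 1 \<or> i = 2" "j = 0 \<or> j = 1 \<or> j = 2" "i \<noteq> j" using w by auto
    then show ?thesis by (elim disjE) (auto simp: numeral_3_eq_3 lessThan_Suc)
  qed
  ultimately show thesis using that by blast
qed

lemma adjI:
  assumes "set w \<subseteq> {..<3}" "length w = m" "i < 3" "j < 3" "q i \<noteq> q j"
  shows "adj q m (word_map q w (q i)) (word_map q w (q j))"
  unfolding adj_def V_0_eq using assms inj_word_map[of q w] by (auto simp: inj_def)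

lemma adj_sym: "adj q m a b \<Longrightarrow> adj q m b a"
  by (auto simp: adj_def)

lemma edge_subset_SG:
  assumes "adj q m a b"
  shows "closed_segment a b \<subseteq> SG q"
proof -
  obtain w i j l where w: "set w \<subseteq> {..<3}" "length w = m" "{i, j, l} = {..<3}"
    "a = word_map q w (q i)" "b = word_map q w (q j)" using adjE[OF assms] by metis
  have lt: "i < 3" "j < 3" using w(3) by auto
  show ?thesis
  proof
    fix x assume "x \<in> closed_segment a b"
    then obtain t where "t \<in> {0..1}" "x = linepath a b t"
      by (auto simp: closed_segment_def linepath_def)
    then have "x = word_map q w (linepath (q i) (q j) t)" "linepath (q i) (q j) t \<in> SG q"
      using w linepath_in_path[of t "q i" "q j"] base_edge_subset_SG[OF lt, of q]
      by (simp add: word_map_linepath, blast)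
    then show "x \<in> SG q" using word_map_in_SG[OF w(1)] by simp
  qed
qed

lemma adj_first_half:
  assumes "adj q m a b"
  shows "adj q (Suc m) a (midpoint a b)"
proof -
  obtain w i j l where w: "set w \<subseteq> {..<3}" "length w = m" "{i, j, l} = {..<3}"
    "a = word_map q w (q i)" "b = word_map q w (q j)" using adjE[OF assms] by metis
  have "i < 3" "j < 3" "q i \<noteq> q j" using w assms by (auto simp: adj_def)
  then have "adj q (Suc m) (word_map q (w @ [i]) (q i)) (word_map q (w @ [i]) (q j))"
    using w by (intro adjI) auto
  then show ?thesis
    by (simp add: word_map_append contraction_fixed contraction_eq_midpoint[of q i "q j"]
        word_map_midpoint w)
qed

section \<open>The slope recursion on an edge\<close>

text \<open>Here \<open>x0, x1, x2\<close> are the vertex values of a cell, \<open>yij\<close> those at its midpoints, and \<open>v01, v02,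
  v12\<close> those at the midpoints of the subcell with vertex values \<open>x0, y01, y02\<close>.  Subtracting
  the third equation from the second removes \<open>x2\<close>; with \<open>y12\<close> taken from the first one, this
  expresses \<open>y02\<close> by the values \<open>x0, y01, x1\<close> on the edge; adding the last
  three expresses \<open>v01\<close> by \<open>x0, y01, y02\<close>.  The factor \<open>2 - t\<close>
  that remains cancels because \<open>6 - \<mu> = (2 - t) (3 - t)\<close>.\<close>

lemma midpoint_equations_imply_slope_recursion:
  fixes \<mu> t :: real
  assumes m01: "(4 - \<mu>) * y01 = x0 + x1 + y02 + y12"
    and m02: "(4 - \<mu>) * y02 = x0 + x2 + y01 + y12"
    and m12: "(4 - \<mu>) * y12 = x1 + x2 + y01 + y02"
    and v01: "(4 - t) * v01 = x0 + y01 + v02 + v12"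
    and v02: "(4 - t) * v02 = x0 + y02 + v01 + v12"
    and v12: "(4 - t) * v12 = y01 + y02 + v01 + v02"
    and \<mu>: "\<mu> = t * (5 - t)" and ne: "\<mu> \<noteq> 5" "t \<noteq> 5" "t \<noteq> 2"
  shows "(4 - t) * (v01 - x0) - (y01 - v01) = (3 - t) / (5 - \<mu>) * ((4 - \<mu>) * (y01 - x0) - (x1 - y01))"
    and "(4 - t) * (y01 - v01) - (v01 - x0) = (3 - t) / (5 - \<mu>) * (x1 - x0)"
proof -
  have "(5 - \<mu>) * (y02 - y12) = x0 - x1" using m02 m12 by (simp add: algebra_simps)
  moreover have "y12 = (4 - \<mu>) * y01 - x0 - x1 - y02" using m01 by simp
  ultimately have y02: "2 * ((5 - \<mu>) * y02) = (5 - \<mu>) * ((4 - \<mu>) * y01 - x0 - x1) + x0 - x1"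
    by (simp add: algebra_simps)
  have S: "(2 - t) * (v01 + v02 + v12) = 2 * (x0 + y01 + y02)"
    using v01 v02 v12 by (simp add: algebra_simps)
  have "(5 - t) * v01 = x0 + y01 + (v01 + v02 + v12)" using v01 by (simp add: algebra_simps)
  then have "(2 - t) * ((5 - t) * v01) = (2 - t) * (x0 + y01) + 2 * (x0 + y01 + y02)"
    using S by (simp add: distrib_left)
  then have V: "(5 - \<mu>) * ((2 - t) * ((5 - t) * v01))
      = (5 - \<mu>) * (4 - t) * (x0 + y01) + ((5 - \<mu>) * ((4 - \<mu>) * y01 - x0 - x1) + x0 - x1)"
    using y02 by algebra
  have pos: "(2 - t) * (5 - \<mu>) \<noteq> 0" "5 - \<mu> \<noteq> 0" using ne by simp_all
  have "(2 - t) * (5 - \<mu>) * ((4 - t) * (v01 - x0) - (y01 - v01))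
      = (2 - t) * (3 - t) * ((4 - \<mu>) * (y01 - x0) - (x1 - y01))"
    using V \<mu> by algebra
  then have "(5 - \<mu>) * ((4 - t) * (v01 - x0) - (y01 - v01)) = (3 - t) * ((4 - \<mu>) * (y01 - x0) - (x1 - y01))"
    using ne(3) by (simp add: mult.assoc)
  then show "(4 - t) * (v01 - x0) - (y01 - v01) = (3 - t) / (5 - \<mu>) * ((4 - \<mu>) * (y01 - x0) - (x1 - y01))"
    using pos(2) by (simp add: eq_divide_eq mult.commute)
  have "(2 - t) * (5 - \<mu>) * ((4 - t) * (y01 - v01) - (v01 - x0)) = (2 - t) * (3 - t) * (x1 - x0)"
    using V \<mu> by algebra
  then have "(5 - \<mu>) * ((4 - t) * (y01 - v01) - (v01 - x0)) = (3 - t) * (x1 - x0)"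
    using ne(3) by (simp add: mult.assoc)
  then show "(4 - t) * (y01 - v01) - (v01 - x0) = (3 - t) / (5 - \<mu>) * (x1 - x0)"
    using pos(2) by (simp add: eq_divide_eq mult.commute)
qed

text \<open>The six equations come from the cell around the edge and from its subcell at \<open>a\<close>.\<close>

lemma edge_slope_recursion:
  assumes q: "equilateral q" and e: "adj q m a b"
    and u1: "graph_eigenfunction q bc (Suc m) u \<mu>"
    and u2: "graph_eigenfunction q bc (Suc (Suc m)) u t"
    and \<mu>: "\<mu> = t * (5 - t)" "\<mu> \<noteq> 5" "t \<noteq> 5" "t \<noteq> 2"
  defines "c \<equiv> midpoint a b"
  defines "d \<equiv> midpoint a c"
  shows "(4 - t) * (u d - u a) - (u c - u d) = (3 - t) / (5 - \<mu>) * ((4 - \<mu>) * (u c - u a) - (u b - u c))"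
    and "(4 - t) * (u c - u d) - (u d - u a) = (3 - t) / (5 - \<mu>) * (u b - u a)"
proof -
  obtain w i j l where w: "set w \<subseteq> {..<3}" "length w = m" and ijl: "{i, j, l} = {..<3}"
    and ab: "a = word_map q w (q i)" "b = word_map q w (q j)"
    using adjE[OF e] by metis
  have perm: "{i, l, j} = {..<3}" "{j, l, i} = {..<3}" "{j, i, l} = {..<3}" using ijl by auto
  have wi: "set (w @ [i]) \<subseteq> {..<3}" "length (w @ [i]) = Suc m" using w ijl by auto
  define z where "z = word_map q w (q l)"
  have sub: "word_map q (w @ [i]) (q i) = a" "word_map q (w @ [i]) (q j) = c"
    "word_map q (w @ [i]) (q l) = midpoint a z"
    by (simp_all add: word_map_append contraction_eq_midpoint word_map_midpoint ab c_def z_def)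
  note eq1 = midpoint_equation[OF q w _ u1] and eq2 = midpoint_equation[OF q wi _ u2]
  note eqs = eq1[OF ijl] eq1[OF perm(1)] eq1[OF perm(2)] eq2[OF ijl] eq2[OF perm(1)] eq2[OF perm(2)]
  note facts = eqs[unfolded sub ab[symmetric] z_def[symmetric] c_def[symmetric] d_def[symmetric]]
  have s: "midpoint b a = c" "midpoint z b = midpoint b z" "midpoint z a = midpoint a z"
      "midpoint (midpoint a z) c = midpoint c (midpoint a z)"
      "midpoint (midpoint a z) a = midpoint a (midpoint a z)" "midpoint c a = d"
    by (simp_all add: c_def d_def midpoint_sym)
  have m:
    "(4 - \<mu>) * u c = u a + u b + u (midpoint a z) + u (midpoint b z)"
    "(4 - \<mu>) * u (midpoint a z) = u a + u z + u c + u (midpoint b z)"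
    "(4 - \<mu>) * u (midpoint b z) = u b + u z + u c + u (midpoint a z)"
    "(4 - t) * u d = u a + u c + u (midpoint a (midpoint a z)) + u (midpoint c (midpoint a z))"
    "(4 - t) * u (midpoint a (midpoint a z)) = u a + u (midpoint a z) + u d + u (midpoint c (midpoint a z))"
    "(4 - t) * u (midpoint c (midpoint a z)) = u c + u (midpoint a z) + u d + u (midpoint a (midpoint a z))"
    using facts by (simp_all add: s)
  show "(4 - t) * (u d - u a) - (u c - u d) = (3 - t) / (5 - \<mu>) * ((4 - \<mu>) * (u c - u a) - (u b - u c))"
    and "(4 - t) * (u c - u d) - (u d - u a) = (3 - t) / (5 - \<mu>) * (u b - u a)"
    by (rule midpoint_equations_imply_slope_recursion[OF m \<mu>])+
qed

text \<open>Scalar multiples are included so that the family is closed under negation.\<close>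

definition edge_profile :: "(nat \<Rightarrow> plane) \<Rightarrow> (plane \<Rightarrow> real) \<Rightarrow> nat \<Rightarrow> (real \<Rightarrow> real) \<Rightarrow> bool" where
  "edge_profile q u m f \<longleftrightarrow>
     (\<exists>a b s. adj q m a b \<and> f = (\<lambda>x. s * u (linepath a b x)))"

lemma edge_profile_linepath:
  "adj q m a b \<Longrightarrow> edge_profile q u m (\<lambda>t. u (linepath a b t))"
  unfolding edge_profile_def by (intro exI[of _ a] exI[of _ b] exI[of _ 1]) simp

lemma linepath_first_half: "linepath a b (x / 2) = linepath a (midpoint a (b::plane)) x"
  by (simp add: linepath_def midpoint_def vec_eq_iff field_simps)

lemma linepath_half: "linepath a b (1 / 2) = midpoint a (b::plane)"
  by (simp add: linepath_def midpoint_def vec_eq_iff field_simps)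

lemma linepath_flip: "linepath a b (1 - x) = linepath b (a::plane) x"
  by (simp add: linepath_def add.commute)

text \<open>The halves of an edge are edges of the next level, so the slope recursion applies at every
  level.\<close>

lemma eigenfunction_edge_family:
  assumes q: "equilateral q" and cont: "continuous_on (SG q) u"
    and u: "\<And>n. n \<ge> m \<Longrightarrow> graph_eigenfunction q bc (Suc n) u (lam (Suc n))"
    and rec: "\<And>n. n \<ge> m \<Longrightarrow> lam (Suc n) = lam (Suc (Suc n)) * (5 - lam (Suc (Suc n)))"
    and le: "\<And>n. n \<ge> m \<Longrightarrow> lam (Suc n) \<le> 5/2"
    and lim: "lam \<longlonglongrightarrow> 0"
  shows "edge_family (\<lambda>n. edge_profile q u (m + n)) (\<lambda>n. lam (Suc (m + n)))"
proof
  fix n f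
  show "lam (Suc (m + n)) \<le> 5/2" using le by simp
  show "(\<lambda>n. lam (Suc (m + n))) \<longlonglongrightarrow> 0"
    using LIMSEQ_ignore_initial_segment[OF lim, of "Suc m"] by (simp add: add.commute)
  assume "edge_profile q u (m + n) f"
  then obtain a b s where e: "adj q (m + n) a b" and f: "f = (\<lambda>x. s * u (linepath a b x))"
    by (auto simp: edge_profile_def)
  show "continuous_on {0..1} f"
    unfolding f
    by (intro continuous_on_mult continuous_on_const continuous_on_compose2[OF cont] continuous_on_linepath)
      (use edge_subset_SG[OF e] in \<open>auto simp: linepath_image_01[symmetric]\<close>)
  show "edge_profile q u (m + n) (\<lambda>x. - f x)"
    unfolding edge_profile_def f using e by (intro exI[of _ a] exI[of _ b] exI[of _ "- s"]) simp
  show "edge_profile q u (m + n) (\<lambda>x. f (1 - x))"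
    unfolding edge_profile_def f linepath_flip using adj_sym[OF e] by blast
  show "edge_profile q u (m + Suc n) (\<lambda>x. f (x / 2))"
    unfolding edge_profile_def f linepath_first_half using adj_first_half[OF e] by auto
  let ?\<mu> = "lam (Suc (m + n))" and ?t = "lam (Suc (m + Suc n))"
  have t: "?\<mu> = ?t * (5 - ?t)" "?\<mu> \<le> 5/2" "?t \<le> 5/2" using rec[of "m + n"] le[of "m + n"] le[of "m + Suc n"] by auto
  \<comment> \<open>The value \<open>2\<close> would belong to the eigenvalue \<open>6 > 5/2\<close> one level up.\<close>
  have "?t \<noteq> 2" using t by auto
  then have ne: "?\<mu> \<noteq> 5" "?t \<noteq> 5" "?t \<noteq> 2" using t(2,3) by auto
  have f_eq: "f 0 = s * u a" "f 1 = s * u b" "f (1/2) = s * u (midpoint a b)"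
    "f (0 / 2) = s * u a" "f (1 / 2 / 2) = s * u (midpoint a (midpoint a b))"
    unfolding f linepath_first_half by (simp_all add: linepath_half linepath_0' linepath_1')
  have r: "(4 - ?t) * (u (midpoint a (midpoint a b)) - u a) - (u (midpoint a b) - u (midpoint a (midpoint a b)))
      = (3 - ?t) / (5 - ?\<mu>) * ((4 - ?\<mu>) * (u (midpoint a b) - u a) - (u b - u (midpoint a b)))"
    "(4 - ?t) * (u (midpoint a b) - u (midpoint a (midpoint a b))) - (u (midpoint a (midpoint a b)) - u a)
      = (3 - ?t) / (5 - ?\<mu>) * (u b - u a)"
    using edge_slope_recursion[OF q e u _ t(1) ne] u[of "m + Suc n"] by simp_all
  show "left_slope ?t (\<lambda>x. f (x / 2)) = (3 - ?t) / (5 - ?\<mu>) * left_slope ?\<mu> f"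
    unfolding left_slope_def f_eq using arg_cong[OF r(1), of "\<lambda>x. s * x"] by (simp only: right_diff_distrib[symmetric] mult.left_commute[of _ s])
  show "right_slope ?t (\<lambda>x. f (x / 2)) = (3 - ?t) / (5 - ?\<mu>) * (f 1 - f 0)"
    unfolding right_slope_def f_eq using arg_cong[OF r(2), of "\<lambda>x. s * x"] by (simp only: right_diff_distrib[symmetric] mult.left_commute[of _ s])
qed

section \<open>Extrema and difference quotients on an edge\<close>

lemma local_extremum_on_uminus:
  "local_extremum_on E (\<lambda>x. - f x) x \<longleftrightarrow> local_extremum_on E f x"
  unfolding local_extremum_on_def by auto

text \<open>Near the point the function takes both larger and smaller values.\<close>

lemma not_local_extremum_if_strict_mono:
  assumes ab: "a \<noteq> b" and mono: "strict_mono_on {r..s} (\<lambda>t. u (linepath a b t))"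
    and rs: "0 \<le> r" "r < t" "t < s" "s \<le> 1"
  shows "\<not> local_extremum_on (closed_segment a b) u (linepath a b t)"
proof
  let ?p = "linepath a b"
  have dist: "dist (?p x) (?p y) = \<bar>x - y\<bar> * dist a b" for x y
  proof -
    have "?p x - ?p y = (x - y) *\<^sub>R (b - a)" by (simp add: linepath_def algebra_simps)
    then show ?thesis by (simp add: dist_norm norm_minus_commute)
  qed
  assume "local_extremum_on (closed_segment a b) u (?p t)"
  then consider "\<forall>\<^sub>F y in at (?p t) within closed_segment a b. u y \<le> u (?p t)"
    | "\<forall>\<^sub>F y in at (?p t) within closed_segment a b. u y \<ge> u (?p t)"
    by (auto simp: local_extremum_on_def)
  then obtain d where d: "d > 0" and
    "(\<forall>y\<in>closed_segment a b. y \<noteq> ?p t \<and> dist y (?p t) < d \<longrightarrow> u y \<le> u (?p t))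
     \<or> (\<forall>y\<in>closed_segment a b. y \<noteq> ?p t \<and> dist y (?p t) < d \<longrightarrow> u y \<ge> u (?p t))"
    by cases (auto simp: eventually_at)
  moreover
  define h where "h = Min {t - r, s - t, d / (2 * dist a b)}"
  have h: "h > 0" "h \<le> t - r" "h \<le> s - t" "h \<le> d / (2 * dist a b)"
    using rs d ab by (auto simp: h_def)
  have "h * dist a b < d"
    using h(4) d ab by (simp add: pos_le_divide_eq)
  then have near: "dist (?p (t + h)) (?p t) < d" "dist (?p (t - h)) (?p t) < d"
    using h(1) by (simp_all add: dist)
  moreover have "?p (t + h) \<in> closed_segment a b" "?p (t - h) \<in> closed_segment a b"
    using h rs by (auto intro!: linepath_in_path)
  moreover have "?p (t + h) \<noteq> ?p t" "?p (t - h) \<noteq> ?p t"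
    using dist[of "t + h" t] dist[of "t - h" t] h(1) ab by auto
  moreover have "u (?p t) < u (?p (t + h))" "u (?p (t - h)) < u (?p t)"
    using h rs by (auto intro!: strict_mono_onD[OF mono])
  ultimately show False by (meson not_le)
qed

lemma single_extremum_if_unimodal:
  fixes e :: "nat \<Rightarrow> plane"
  assumes ab: "e 0 \<noteq> e 1" and c: "0 < c" "c < 1"
    and inc: "strict_mono_on {0..c} (\<lambda>t. u (linepath (e 0) (e 1) t))"
    and dec: "strict_antimono_on {c..1} (\<lambda>t. u (linepath (e 0) (e 1) t))"
  shows "single_extremum_on_edge e u"
  unfolding single_extremum_on_edge_def
proof (rule ex1I)
  let ?p = "linepath (e 0) (e 1)"
  have inj: "?p s = ?p t \<longleftrightarrow> s = t" for s t
  proof -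
    have "?p s - ?p t = (s - t) *\<^sub>R (e 1 - e 0)" by (simp add: linepath_def algebra_simps)
    then show ?thesis using ab by auto
  qed
  have interior: "?p t \<notin> {e 0, e 1} \<longleftrightarrow> t \<noteq> 0 \<and> t \<noteq> 1" for t
    using inj[of t 0] inj[of t 1] by (simp add: linepath_0' linepath_1')
  have "u (?p t) \<le> u (?p c)" if "t \<in> {0..1}" for t
  proof -
    consider "t < c" | "t = c" | "c < t" by linarith
    then show ?thesis
    proof cases
      case 1
      then show ?thesis using strict_mono_onD[OF inc, of t c] that c by simp
    next
      case 3
      then show ?thesis using monotone_onD[OF dec, of c t] that c by simp
    qed simp
  qed
  then have "u y \<le> u (?p c)" if "y \<in> closed_segment (e 0) (e 1)" for y
    using that by (auto simp flip: linepath_image_01)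
  moreover have "?p c \<in> closed_segment (e 0) (e 1)" using c by (intro linepath_in_path) auto
  ultimately have "local_extremum_on (closed_segment (e 0) (e 1)) u (?p c)"
    unfolding local_extremum_on_def by (auto simp: eventually_at_filter)
  then show "?p c \<notin> {e 0, e 1} \<and> local_extremum_on (closed_segment (e 0) (e 1)) u (?p c)"
    using interior[of c] c by simp
next
  fix x
  let ?p = "linepath (e 0) (e 1)"
  assume x: "x \<notin> {e 0, e 1} \<and> local_extremum_on (closed_segment (e 0) (e 1)) u x"
  then have "x \<in> ?p ` {0..1}" by (simp add: local_extremum_on_def linepath_image_01)
  then obtain t where t: "x = ?p t" "0 \<le> t" "t \<le> 1" by auto
  have "t \<noteq> 0" "t \<noteq> 1" using x t by (auto simp: linepath_0' linepath_1')
  then have t01: "0 < t" "t < 1" using t by auto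
  have "\<not> t < c"
    using not_local_extremum_if_strict_mono[OF ab inc, of t] x t(1) t01 c by auto
  moreover have "\<not> c < t"
    using not_local_extremum_if_strict_mono[OF ab dec[unfolded strict_antimono_on_iff_uminus], of t]
      x t(1) t01 c by (auto simp: local_extremum_on_uminus)
  ultimately show "x = ?p c" using t(1) by simp
qed

lemma single_extremum_on_edge_uminus:
  "single_extremum_on_edge e (\<lambda>x. - u x) \<longleftrightarrow> single_extremum_on_edge e u"
  by (simp add: single_extremum_on_edge_def local_extremum_on_uminus)

lemma word_map_replicate: "word_map p (replicate l i) x = linepath (p i) x (1 / 2 ^ l)"
proof (induction l)
  case 0
  show ?case by (simp add: linepath_1')
next
  case (Suc l)
  have "contraction p i (linepath (p i) x t) = linepath (p i) x (t / 2)" for t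
    by (simp add: contraction_def linepath_def vec_eq_iff field_simps)
  then show ?case using Suc by (simp add: mult.commute)
qed

lemma difference_quotient_eq_scaled_increment:
  "\<bar>u (linepath a b (1 / 2 ^ l)) - u a\<bar> / norm (linepath a b (1 / 2 ^ l) - a)
    = \<bar>scaled_increment (\<lambda>t. u (linepath a b t)) l\<bar> / norm (b - a)"
proof -
  have "linepath a b (1 / 2 ^ l) - a = (1 / 2 ^ l) *\<^sub>R (b - a)"
    by (simp add: linepath_def algebra_simps)
  then show ?thesis by (simp add: scaled_increment_def abs_mult linepath_0')
qed

context edge_family
begin

text \<open>The limits \<open>\<alpha>\<close> and \<open>\<beta>\<close> are both of this form, the latter for the edge traversed backwards.\<close>

lemma difference_quotient_limit:
  assumes P: "P n (\<lambda>t. u (linepath a b t))" and "a \<noteq> b"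
  shows "(\<lambda>l. ereal (\<bar>u (linepath a b (1 / 2 ^ l)) - u a\<bar> / norm (linepath a b (1 / 2 ^ l) - a)))
    \<longlonglongrightarrow> (if L n (\<lambda>t. u (linepath a b t)) = 0 then 0 else \<infinity>)"
proof (cases "L n (\<lambda>t. u (linepath a b t)) = 0")
  case True
  have "(\<lambda>l. \<bar>scaled_increment (\<lambda>t. u (linepath a b t)) l\<bar> / norm (b - a)) \<longlonglongrightarrow> \<bar>0\<bar> / norm (b - a)"
    using assms(2) by (intro tendsto_intros scaled_increment_tendsto_0[OF P True]) simp
  then show ?thesis
    unfolding difference_quotient_eq_scaled_increment by (simp add: True zero_ereal_def)
next
  case False
  have "filterlim (\<lambda>l. 1 / norm (b - a) * \<bar>scaled_increment (\<lambda>t. u (linepath a b t)) l\<bar>) at_top sequentially"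
    using assms(2)
    by (intro filterlim_tendsto_pos_mult_at_top[OF tendsto_const] abs_scaled_increment_at_top[OF P False]) simp
  then show ?thesis
    unfolding difference_quotient_eq_scaled_increment by (simp add: False tendsto_PInfty_eq_at_top)
qed

end

section \<open>Eigenfunctions on edges\<close>

theorem theorem1p3:
  fixes q :: "nat \<Rightarrow> plane" and bc :: boundary_cond and u :: "plane \<Rightarrow> real"
    and \<Lambda> :: real and lam eps :: "nat \<Rightarrow> real" and m0 m1 m :: nat
    and e :: "nat \<Rightarrow> plane" and E :: "plane set"
  assumes "equilateral q"
    and "eigenfunction q u \<Lambda>" and "satisfies_bc q bc u"
    and "spectral_data q bc u \<Lambda> lam m0"
    and "epsilon_sequence lam m0 eps"
    and "level_of_fixation m0 eps m1"
    and "is_edge q m e E" and "m + 1 \<ge> m1"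
    and "\<not> u constant_on E"
  shows "(ereal (1 / (4 - lam (m + 1))) \<le> edge_ratio e u \<and> edge_ratio e u \<le> ereal (4 - lam (m + 1))
            \<longrightarrow> strictly_monotone_on_edge e u)
       \<and> (\<not> (ereal (1 / (4 - lam (m + 1))) \<le> edge_ratio e u \<and> edge_ratio e u \<le> ereal (4 - lam (m + 1)))
            \<longrightarrow> single_extremum_on_edge e u)
       \<and> (edge_ratio e u = ereal (4 - lam (m + 1)) \<longrightarrow> has_alpha e u 0)
       \<and> (edge_ratio e u \<noteq> ereal (4 - lam (m + 1)) \<longrightarrow> has_alpha e u \<infinity>)
       \<and> (edge_ratio e u = ereal (1 / (4 - lam (m + 1))) \<longrightarrow> has_beta e u 0)
       \<and> (edge_ratio e u \<noteq> ereal (1 / (4 - lam (m + 1))) \<longrightarrow> has_beta e u \<infinity>)"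
proof -
  have m: "m0 \<le> m" and eps: "\<And>n. n \<ge> m \<Longrightarrow> eps (Suc n) = -1"
    using assms(6,8) by (auto simp: level_of_fixation_def)
  have dec: "\<And>n. n \<ge> m0 \<Longrightarrow> graph_eigenfunction q bc n u (lam n)"
    "\<And>n. n \<ge> m0 \<Longrightarrow> lam n = lam (Suc n) * (5 - lam (Suc n))"
    "(\<lambda>n. 3/2 * (5 ^ n * lam n)) \<longlonglongrightarrow> \<Lambda>"
    using assms(4) unfolding spectral_data_def decimates_from_def by blast+
  \<comment> \<open>With \<open>\<epsilon> = -1\<close> the eigenvalue is the smaller root of the quadratic.  The discriminant has
    to be checked, as \<open>sqrt\<close> is negative on negative numbers.\<close>
  have le: "lam (Suc n) \<le> 5/2" if n: "n \<ge> m" for n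
  proof -
    have "25 - 4 * lam n = (5 - 2 * lam (Suc n))\<^sup>2"
      using dec(2)[of n] n m by (simp add: power2_eq_square algebra_simps)
    then have "25 - 4 * lam n \<ge> 0" by simp
    moreover have "lam (Suc n) = (5 - sqrt (25 - 4 * lam n)) / 2"
      using assms(5) eps[OF n] n m by (simp add: epsilon_sequence_def)
    ultimately show ?thesis by simp
  qed
  \<comment> \<open>The rescaled eigenvalues converge, so the eigenvalues themselves decay at least like \<open>5^-n\<close>.\<close>
  have "(\<lambda>n. (3/2 * (5 ^ n * lam n)) * (2/3 * (1/5) ^ n)) \<longlonglongrightarrow> \<Lambda> * (2/3 * 0)"
    by (intro tendsto_mult dec(3) tendsto_const LIMSEQ_realpow_zero) auto
  moreover have "(\<lambda>n. (3/2 * (5 ^ n * lam n)) * (2/3 * (1/5) ^ n)) = lam"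
    by (simp add: power_one_over)
  ultimately have lim: "lam \<longlonglongrightarrow> 0" by (simp only: mult_zero_right)
  have cont: "continuous_on (SG q) u"
    using assms(2) by (auto simp: eigenfunction_def has_laplacian_def)
  have eigen: "\<And>n. n \<ge> m \<Longrightarrow> graph_eigenfunction q bc (Suc n) u (lam (Suc n))"
    using m by (intro dec(1)) simp
  have decimation: "\<And>n. n \<ge> m \<Longrightarrow> lam (Suc n) = lam (Suc (Suc n)) * (5 - lam (Suc (Suc n)))"
    using m by (intro dec(2)) simp
  interpret edge_family "\<lambda>n. edge_profile q u (m + n)" "\<lambda>n. lam (Suc (m + n))"
    by (rule eigenfunction_edge_family[OF assms(1) cont eigen decimation le lim])
  define \<kappa> where "\<kappa> = 4 - lam (m + 1)"
  have \<kappa>: "\<kappa> > 1" using le[of m] by (simp add: \<kappa>_def)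
  have edge: "adj q m (e 0) (e 1)" "E = closed_segment (e 0) (e 1)" and ne: "e 0 \<noteq> e 1"
    using assms(7) by (auto simp: is_edge_def adj_def)
  define f where "f = (\<lambda>t. u (linepath (e 0) (e 1) t))"
  define g where "g = (\<lambda>t. u (linepath (e 1) (e 0) t))"
  have P: "edge_profile q u (m + 0) f"
    unfolding f_def using edge(1) by (intro edge_profile_linepath) simp
  have g: "g = (\<lambda>t. f (1 - t))" by (simp add: f_def g_def linepath_flip)
  have Pg: "edge_profile q u (m + 0) g" unfolding g by (rule reflect[OF P])
  let ?c = "midpoint (e 0) (e 1)"
  define d0 d1 where "d0 = u ?c - u (e 0)" and "d1 = u (e 1) - u ?c"
  have L: "L 0 f = \<kappa> * d0 - d1" and R: "R 0 f = \<kappa> * d1 - d0"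
    by (simp_all add: left_slope_def right_slope_def f_def \<kappa>_def d0_def d1_def
        linepath_half linepath_0' linepath_1')
  have Lg: "L 0 g = - R 0 f" unfolding g by (rule L_reflect)
  have nz: "L 0 f \<noteq> 0 \<or> R 0 f \<noteq> 0"
  proof (rule ccontr)
    assume "\<not> (L 0 f \<noteq> 0 \<or> R 0 f \<noteq> 0)"
    then have slopes: "L 0 f = 0" "R 0 f = 0" by simp_all
    have "u x = f 0" if x: "x \<in> E" for x
    proof -
      obtain t where t: "t \<in> {0..1}" "x = linepath (e 0) (e 1) t"
        using x unfolding edge(2) linepath_image_01[symmetric] by blast
      have "f t = f 0" by (rule constant_if_slopes_vanish[OF P slopes t(1)])
      then show ?thesis using t(2) by (simp add: f_def)
    qed
    then show False using assms(9) unfolding constant_on_def by blast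
  qed
  have ratio: "edge_ratio e u = (if d0 = 0 then \<infinity> else ereal (d1 / d0))"
    by (simp add: edge_ratio_def d0_def d1_def Let_def)
  have ratio_\<kappa>: "edge_ratio e u = ereal \<kappa> \<longleftrightarrow> L 0 f = 0"
    using nz \<kappa> unfolding ratio L R by (auto simp: divide_eq_eq)
  have ratio_inv_\<kappa>: "edge_ratio e u = ereal (1 / \<kappa>) \<longleftrightarrow> R 0 f = 0"
    using nz \<kappa> unfolding ratio L R by (auto simp: divide_eq_eq eq_divide_eq mult.commute)
  have interval: "ereal (1 / \<kappa>) \<le> edge_ratio e u \<and> edge_ratio e u \<le> ereal \<kappa>
    \<longleftrightarrow> (L 0 f \<ge> 0 \<and> R 0 f \<ge> 0) \<or> (L 0 f \<le> 0 \<and> R 0 f \<le> 0)"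
  proof -
    \<comment> \<open>Since \<open>\<kappa> > 1\<close>, the slopes are not both nonpositive if \<open>d0 > 0\<close>, nor both nonnegative
      if \<open>d0 < 0\<close>.\<close>
    have same_sign: "\<not> (\<kappa> * x \<le> y \<and> \<kappa> * y \<le> x)" if "x > 0" for x y
    proof
      assume *: "\<kappa> * x \<le> y \<and> \<kappa> * y \<le> x"
      moreover have "x < \<kappa> * x" using \<kappa> that by simp
      ultimately have "x < y" by linarith
      then have "y < \<kappa> * y" using \<kappa> that by simp
      then show False using * \<open>x < y\<close> by linarith
    qed
    consider "d0 = 0" | "d0 > 0" | "d0 < 0" by linarith
    then show ?thesis
    proof cases
      case 1
      then have "d1 \<noteq> 0" using nz unfolding L R by auto
      then show ?thesis using \<kappa> 1 unfolding ratio L R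
        by (auto simp: zero_le_mult_iff mult_le_0_iff)
    next
      case 2
      have "ereal (1 / \<kappa>) \<le> edge_ratio e u \<longleftrightarrow> R 0 f \<ge> 0" "edge_ratio e u \<le> ereal \<kappa> \<longleftrightarrow> L 0 f \<ge> 0"
        using \<kappa> 2 unfolding ratio L R by (auto simp: field_simps)
      moreover have "\<not> (L 0 f \<le> 0 \<and> R 0 f \<le> 0)"
        using same_sign[of d0 d1] 2 unfolding L R by simp
      ultimately show ?thesis by blast
    next
      case 3
      have "ereal (1 / \<kappa>) \<le> edge_ratio e u \<longleftrightarrow> R 0 f \<le> 0" "edge_ratio e u \<le> ereal \<kappa> \<longleftrightarrow> L 0 f \<le> 0"
        using \<kappa> 3 unfolding ratio L R by (auto simp: field_simps)
      moreover have "\<not> (L 0 f \<ge> 0 \<and> R 0 f \<ge> 0)"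
        using same_sign[of "- d0" "- d1"] 3 unfolding L R by simp
      ultimately show ?thesis by blast
    qed
  qed
  have monotone: "strictly_monotone_on_edge e u"
    if "(L 0 f \<ge> 0 \<and> R 0 f \<ge> 0) \<or> (L 0 f \<le> 0 \<and> R 0 f \<le> 0)"
    using that strictly_increasing[OF P] strictly_decreasing[OF P] nz
    unfolding strictly_monotone_on_edge_def f_def comp_def by blast
  have extremum: "single_extremum_on_edge e u"
    if signs: "\<not> ((L 0 f \<ge> 0 \<and> R 0 f \<ge> 0) \<or> (L 0 f \<le> 0 \<and> R 0 f \<le> 0))"
  proof -
    consider "L 0 f > 0" "R 0 f < 0" | "L 0 f < 0" "R 0 f > 0" using signs by linarith
    then show ?thesis
    proof cases
      case 1
      from unimodal[OF P this] show ?thesis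
        unfolding f_def using single_extremum_if_unimodal[where e = e, OF ne] by metis
    next
      case 2
      then have "L 0 (\<lambda>t. - f t) > 0" "R 0 (\<lambda>t. - f t) < 0" unfolding L_negate R_negate by linarith+
      from unimodal[OF negate[OF P] this] obtain c where
        "0 < c" "c < 1" "strict_mono_on {0..c} (\<lambda>t. - f t)" "strict_antimono_on {c..1} (\<lambda>t. - f t)" .
      then have "single_extremum_on_edge e (\<lambda>x. - u x)"
        unfolding f_def by (rule single_extremum_if_unimodal[where e = e, OF ne])
      then show ?thesis by (simp add: single_extremum_on_edge_uminus)
    qed
  qed
  have alpha: "has_alpha e u (if L 0 f = 0 then 0 else \<infinity>)"
    using difference_quotient_limit[OF P[unfolded f_def] ne]
    unfolding has_alpha_def sub_endpoint_def word_map_replicate f_def .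
  have beta: "has_beta e u (if R 0 f = 0 then 0 else \<infinity>)"
    using difference_quotient_limit[OF Pg[unfolded g_def] ne[symmetric]] Lg
    unfolding has_beta_def sub_endpoint_def word_map_replicate g_def by simp
  show ?thesis
    unfolding \<kappa>_def[symmetric] interval ratio_\<kappa> ratio_inv_\<kappa>
    using monotone extremum alpha beta by presburger
qed

end
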